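(* Let $\Phi:\mathbb{P}^2\dashrightarrow\mathbb{P}^2$ be a birational self-map over $\mathbb{C}$. Assume that $\Phi^k$ is an endomorphism of $\mathbb{P}^2$ for some $k\ge 1$. Moreover, assume that there does not exist a non-constant rational map $f:\mathbb{P}^2\dashrightarrow\mathbb{P}^1$ such that $f\circ\Phi=f$. Then $\Phi$ itself is regular.
   Context: $\Phi^k$ denotes the $k$-fold composition of $\Phi$ with itself, as a rational map. An endomorphism of $\mathbb{P}^2$ is a rational self-map that is regular everywhere, i.e. extends to a morphism $\mathbb{P}^2\to\mathbb{P}^2$. *)

theory Defs
  imports "HOL-Analysis.Analysis" "HOL-Computational_Algebra.Polynomial"
begin

text \<open>Since \<open>\<complex>\<close> is infinite, homogeneous polynomials over \<open>\<complex>\<close> are identified with the functions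
  they induce. The sum ranges over the finite set of exponent vectors of total degree \<open>d\<close>.\<close>

definition homogeneous_form :: "nat \<Rightarrow> (complex ^ 'n \<Rightarrow> complex) \<Rightarrow> bool" where
  "homogeneous_form d p \<longleftrightarrow>
     (\<exists>c :: ('n \<Rightarrow> nat) \<Rightarrow> complex.
        p = (\<lambda>x. \<Sum>\<alpha> | (\<Sum>i\<in>UNIV. \<alpha> i) = d. c \<alpha> * (\<Prod>i\<in>UNIV. (x $ i) ^ \<alpha> i)))"

definition homogeneous_map :: "(complex ^ 'n \<Rightarrow> complex ^ 'm) \<Rightarrow> bool" where
  "homogeneous_map F \<longleftrightarrow>
     (\<exists>d. \<forall>i. homogeneous_form d (\<lambda>x. F x $ i)) \<and> (\<exists>x. F x \<noteq> 0)"

text \<open>Two tuples of forms \<open>[F\<^sub>0 : \<dots> : F\<^sub>m]\<close> and \<open>[G\<^sub>0 : \<dots> : G\<^sub>m]\<close> (possibly of different degrees, and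
  possibly with common factors) give the same rational map iff \<open>F\<^sub>i G\<^sub>j = F\<^sub>j G\<^sub>i\<close> for all \<open>i, j\<close>.\<close>

definition same_rational_map ::
  "(complex ^ 'n \<Rightarrow> complex ^ 'm) \<Rightarrow> (complex ^ 'n \<Rightarrow> complex ^ 'm) \<Rightarrow> bool" where
  "same_rational_map F G \<longleftrightarrow> homogeneous_map F \<and> homogeneous_map G \<and>
     (\<forall>x i j. F x $ i * G x $ j = F x $ j * G x $ i)"

lemma finite_exponents: "finite {\<alpha> :: 'n::finite \<Rightarrow> nat. (\<Sum>i\<in>UNIV. \<alpha> i) = d}"
proof (rule finite_subset)
  show "{\<alpha> :: 'n \<Rightarrow> nat. (\<Sum>i\<in>UNIV. \<alpha> i) = d} \<subseteq> (UNIV :: 'n set) \<rightarrow>\<^sub>E {..d}"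
    by (auto simp: PiE_def intro: member_le_sum)
  show "finite ((UNIV :: 'n set) \<rightarrow>\<^sub>E {..d})"
    by (rule finite_PiE) auto
qed

lemma homogeneous_form_monomial:
  fixes \<alpha> :: "'n::finite \<Rightarrow> nat"
  assumes "(\<Sum>i\<in>UNIV. \<alpha> i) = d"
  shows "homogeneous_form d (\<lambda>x. a * (\<Prod>i\<in>UNIV. (x $ i) ^ \<alpha> i))"
  unfolding homogeneous_form_def
proof (intro exI ext)
  fix x :: "complex ^ 'n"
  let ?S = "{\<beta> :: 'n \<Rightarrow> nat. (\<Sum>i\<in>UNIV. \<beta> i) = d}"
  have "(\<Sum>\<beta>\<in>?S. (if \<beta> = \<alpha> then a else 0) * (\<Prod>i\<in>UNIV. (x $ i) ^ \<beta> i))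
      = (\<Sum>\<beta>\<in>?S. if \<beta> = \<alpha> then a * (\<Prod>i\<in>UNIV. (x $ i) ^ \<alpha> i) else 0)"
    by (intro sum.cong) auto
  also have "\<dots> = a * (\<Prod>i\<in>UNIV. (x $ i) ^ \<alpha> i)"
    using assms by (simp add: finite_exponents)
  finally show "a * (\<Prod>i\<in>UNIV. (x $ i) ^ \<alpha> i) =
      (\<Sum>\<beta>\<in>?S. (if \<beta> = \<alpha> then a else 0) * (\<Prod>i\<in>UNIV. (x $ i) ^ \<beta> i))" by simp
qed

lemma homogeneous_form_0: "homogeneous_form d (\<lambda>x. 0)"
  unfolding homogeneous_form_def by (rule exI[of _ "\<lambda>_. 0"]) simp

lemma homogeneous_form_add:
  assumes "homogeneous_form d p" "homogeneous_form d q"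
  shows "homogeneous_form d (\<lambda>x. p x + q x)"
proof -
  from assms obtain a b where
    "p = (\<lambda>x. \<Sum>\<alpha> | (\<Sum>i\<in>UNIV. \<alpha> i) = d. a \<alpha> * (\<Prod>i\<in>UNIV. (x $ i) ^ \<alpha> i))"
    "q = (\<lambda>x. \<Sum>\<alpha> | (\<Sum>i\<in>UNIV. \<alpha> i) = d. b \<alpha> * (\<Prod>i\<in>UNIV. (x $ i) ^ \<alpha> i))"
    unfolding homogeneous_form_def by blast
  then show ?thesis
    unfolding homogeneous_form_def
    by (intro exI[of _ "\<lambda>\<alpha>. a \<alpha> + b \<alpha>"]) (simp add: sum.distrib distrib_right)
qed

lemma homogeneous_form_sum:
  assumes "\<And>s. s \<in> S \<Longrightarrow> homogeneous_form d (p s)"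
  shows "homogeneous_form d (\<lambda>x. \<Sum>s\<in>S. p s x)"
  using assms
proof (induction S rule: infinite_finite_induct)
  case (insert s S)
  then show ?case using homogeneous_form_add[of d "p s" "\<lambda>x. \<Sum>s\<in>S. p s x"] by simp
qed (simp_all add: homogeneous_form_0)

lemma homogeneous_form_mult:
  fixes p q :: "complex ^ 'n \<Rightarrow> complex"
  assumes "homogeneous_form d p" "homogeneous_form e q"
  shows "homogeneous_form (d + e) (\<lambda>x. p x * q x)"
proof -
  from assms obtain a b where
    p: "p = (\<lambda>x. \<Sum>\<alpha> | (\<Sum>i\<in>UNIV. \<alpha> i) = d. a \<alpha> * (\<Prod>i\<in>UNIV. (x $ i) ^ \<alpha> i))" and
    q: "q = (\<lambda>x. \<Sum>\<alpha> | (\<Sum>i\<in>UNIV. \<alpha> i) = e. b \<alpha> * (\<Prod>i\<in>UNIV. (x $ i) ^ \<alpha> i))"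
    unfolding homogeneous_form_def by blast
  have "(\<lambda>x. p x * q x) = (\<lambda>x. \<Sum>\<alpha> | (\<Sum>i\<in>UNIV. \<alpha> i) = d. \<Sum>\<beta> | (\<Sum>i\<in>UNIV. \<beta> i) = e.
      (a \<alpha> * b \<beta>) * (\<Prod>i\<in>UNIV. (x $ i) ^ (\<lambda>i. \<alpha> i + \<beta> i) i))"
    unfolding p q by (simp add: sum_product power_add prod.distrib mult_ac)
  moreover have "homogeneous_form (d + e) (\<lambda>x. \<Sum>\<alpha> | (\<Sum>i\<in>UNIV. \<alpha> i) = d. \<Sum>\<beta> | (\<Sum>i\<in>UNIV. \<beta> i) = e.
      (a \<alpha> * b \<beta>) * (\<Prod>i\<in>UNIV. (x $ i) ^ (\<lambda>i. \<alpha> i + \<beta> i) i))"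
    by (intro homogeneous_form_sum homogeneous_form_monomial) (auto simp: sum.distrib)
  ultimately show ?thesis by simp
qed

lemma homogeneous_form_const: "homogeneous_form 0 (\<lambda>x. a)"
  using homogeneous_form_monomial[of "\<lambda>_. 0" 0 a] by simp

lemma homogeneous_form_minor:
  assumes "homogeneous_form d p" "homogeneous_form e q"
    and "homogeneous_form d p'" "homogeneous_form e q'"
  shows "homogeneous_form (d + e) (\<lambda>x. p x * q x - p' x * q' x)"
proof -
  have "homogeneous_form (d + e) (\<lambda>x. - (p' x * q' x))"
    using homogeneous_form_mult[OF homogeneous_form_const[of "-1"]
        homogeneous_form_mult[OF assms(3,4)]] by simp
  from homogeneous_form_add[OF homogeneous_form_mult[OF assms(1,2)] this] show ?thesis by simp
qed

lemma homogeneous_form_power: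
  assumes "homogeneous_form d p"
  shows "homogeneous_form (d * k) (\<lambda>x. p x ^ k)"
proof (induction k)
  case 0
  show ?case using homogeneous_form_const[of 1] by simp
next
  case (Suc k)
  show ?case using homogeneous_form_mult[OF assms Suc] by simp
qed

lemma homogeneous_form_prod:
  assumes "finite S" "\<And>s. s \<in> S \<Longrightarrow> homogeneous_form (e s) (p s)"
  shows "homogeneous_form (\<Sum>s\<in>S. e s) (\<lambda>x. \<Prod>s\<in>S. p s x)"
  using assms
proof (induction S rule: finite_induct)
  case empty
  show ?case using homogeneous_form_const[of 1] by simp
next
  case (insert s S)
  then show ?case using homogeneous_form_mult[of "e s" "p s"] by simp
qed

lemma homogeneous_form_coord: "homogeneous_form 1 (\<lambda>x :: complex ^ 'n. x $ i)"
proof -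
  have *: "(\<Prod>j\<in>UNIV. (x $ j) ^ (if j = i then 1 else 0)) = x $ i" for x :: "complex ^ 'n"
  proof -
    have "(\<Prod>j\<in>UNIV. (x $ j) ^ (if j = i then 1 else 0)) = (\<Prod>j\<in>UNIV. if j = i then x $ i else 1)"
      by (intro prod.cong) auto
    then show ?thesis by simp
  qed
  show ?thesis
    using homogeneous_form_monomial[of "\<lambda>j. if j = i then 1 else 0" 1 1] by (simp only: *) simp
qed

lemma homogeneous_form_compose:
  fixes p :: "complex ^ 'm \<Rightarrow> complex" and F :: "complex ^ 'n \<Rightarrow> complex ^ 'm"
  assumes "homogeneous_form d p" "\<And>i. homogeneous_form e (\<lambda>x. F x $ i)"
  shows "homogeneous_form (e * d) (\<lambda>x. p (F x))"
proof -
  from assms obtain a where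
    p: "p = (\<lambda>x. \<Sum>\<alpha> | (\<Sum>i\<in>UNIV. \<alpha> i) = d. a \<alpha> * (\<Prod>i\<in>UNIV. (x $ i) ^ \<alpha> i))"
    unfolding homogeneous_form_def by blast
  have "homogeneous_form (e * d) (\<lambda>x. a \<alpha> * (\<Prod>i\<in>UNIV. (F x $ i) ^ \<alpha> i))"
    if \<alpha>: "(\<Sum>i\<in>UNIV. \<alpha> i) = d" for \<alpha> :: "'m \<Rightarrow> nat"
  proof -
    have "homogeneous_form (\<Sum>i\<in>UNIV. e * \<alpha> i) (\<lambda>x. \<Prod>i\<in>UNIV. (F x $ i) ^ \<alpha> i)"
      by (intro homogeneous_form_prod homogeneous_form_power assms) simp
    from homogeneous_form_mult[OF homogeneous_form_const[of "a \<alpha>"] this] show ?thesis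
      using \<alpha> by (simp flip: sum_distrib_left)
  qed
  then show ?thesis unfolding p by (intro homogeneous_form_sum) simp
qed

lemma homogeneous_form_scale:
  fixes p :: "complex ^ 'n \<Rightarrow> complex"
  assumes "homogeneous_form d p"
  shows "p (t *s x) = t ^ d * p x"
proof -
  from assms obtain a where
    p: "p = (\<lambda>x. \<Sum>\<alpha> | (\<Sum>i\<in>UNIV. \<alpha> i) = d. a \<alpha> * (\<Prod>i\<in>UNIV. (x $ i) ^ \<alpha> i))"
    unfolding homogeneous_form_def by blast
  show ?thesis
    unfolding p by (auto simp: power_mult_distrib prod.distrib sum_distrib_left mult_ac
        simp flip: power_sum intro!: sum.cong)
qed

lemma homogeneous_form_on_line:
  fixes p :: "complex ^ 'n \<Rightarrow> complex"
  assumes "homogeneous_form d p"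
  shows "\<exists>P :: complex poly. \<forall>t. poly P t = p (x + t *s y)"
proof -
  from assms obtain a where
    p: "p = (\<lambda>x. \<Sum>\<alpha> | (\<Sum>i\<in>UNIV. \<alpha> i) = d. a \<alpha> * (\<Prod>i\<in>UNIV. (x $ i) ^ \<alpha> i))"
    unfolding homogeneous_form_def by blast
  show ?thesis
    unfolding p
    by (rule exI[of _ "\<Sum>\<alpha> | (\<Sum>i\<in>UNIV. \<alpha> i) = d. smult (a \<alpha>) (\<Prod>i\<in>UNIV. [:x $ i, y $ i:] ^ \<alpha> i)"])
       (simp add: poly_sum poly_prod)
qed

lemma homogeneous_form_zero_product:
  fixes p q :: "complex ^ 'n \<Rightarrow> complex"
  assumes p: "homogeneous_form d p" and q: "homogeneous_form e q"
    and pq: "\<And>x. p x * q x = 0" and y: "q y \<noteq> 0"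
  shows "p x = 0"
proof -
  obtain P where P: "\<And>t. poly P t = p (x + t *s (y - x))"
    using homogeneous_form_on_line[OF p, of x "y - x"] by blast
  obtain Q where Q: "\<And>t. poly Q t = q (x + t *s (y - x))"
    using homogeneous_form_on_line[OF q, of x "y - x"] by blast
  have "poly (P * Q) t = 0" for t using pq by (simp add: P Q)
  then have "P * Q = 0" using poly_all_0_iff_0 by blast
  moreover have "poly Q 1 \<noteq> 0" using y by (simp add: Q)
  ultimately have "P = 0" by auto
  then show ?thesis using P[of 0] by simp
qed

lemma homogeneous_map_compose:
  assumes "homogeneous_map G" "homogeneous_map F" "G (F x) \<noteq> 0"
  shows "homogeneous_map (G \<circ> F)"
proof -
  obtain d e where "\<And>i. homogeneous_form d (\<lambda>x. G x $ i)" "\<And>i. homogeneous_form e (\<lambda>x. F x $ i)"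
    using assms unfolding homogeneous_map_def by blast
  then have "homogeneous_form (e * d) (\<lambda>x. (G \<circ> F) x $ i)" for i
    using homogeneous_form_compose[of d "\<lambda>x. G x $ i" e F] by simp
  then show ?thesis using assms(3) unfolding homogeneous_map_def o_def by blast
qed

lemma same_rational_map_sym: "same_rational_map F G \<Longrightarrow> same_rational_map G F"
  unfolding same_rational_map_def by (simp add: mult.commute)

lemma same_rational_map_trans:
  assumes FG: "same_rational_map F G" and GH: "same_rational_map G H"
  shows "same_rational_map F H"
proof -
  have hom: "homogeneous_map F" "homogeneous_map G" "homogeneous_map H"
    and fg: "\<And>x i j. F x $ i * G x $ j = F x $ j * G x $ i"
    and gh: "\<And>x i j. G x $ i * H x $ j = G x $ j * H x $ i"
    using FG GH unfolding same_rational_map_def by blast+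
  obtain a b c where a: "\<And>i. homogeneous_form a (\<lambda>x. F x $ i)"
    and b: "\<And>i. homogeneous_form b (\<lambda>x. G x $ i)"
    and c: "\<And>i. homogeneous_form c (\<lambda>x. H x $ i)"
    using hom unfolding homogeneous_map_def by blast
  obtain y where "G y \<noteq> 0" using hom unfolding homogeneous_map_def by blast
  then obtain k where k: "G y $ k \<noteq> 0" by (auto simp: vec_eq_iff)
  have "F x $ i * H x $ j = F x $ j * H x $ i" for x i j
  proof -
    have minor: "homogeneous_form (a + c) (\<lambda>x. F x $ i * H x $ j - (F x $ j * H x $ i))"
      by (intro homogeneous_form_minor a c)
    have "(F x $ i * H x $ j - (F x $ j * H x $ i)) * G x $ k = 0" for x
    proof -
      have "F x $ i * H x $ j * G x $ k = F x $ k * (G x $ i * H x $ j)"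
        using fg[of x i k] by (simp add: mult_ac)
      also have "\<dots> = F x $ k * (G x $ j * H x $ i)" using gh[of x i j] by simp
      also have "\<dots> = F x $ j * H x $ i * G x $ k" using fg[of x j k] by (simp add: mult_ac)
      finally show ?thesis by (simp add: algebra_simps)
    qed
    from homogeneous_form_zero_product[OF minor b[of k] this k, of x] show ?thesis by simp
  qed
  then show ?thesis using hom unfolding same_rational_map_def by blast
qed

lemma homogeneous_map_const: "v \<noteq> 0 \<Longrightarrow> homogeneous_map (\<lambda>_. v)"
  unfolding homogeneous_map_def using homogeneous_form_const by blast

lemma homogeneous_map_id: "homogeneous_map (\<lambda>x :: complex ^ 'n. x)"
proof -
  have "(vec 1 :: complex ^ 'n) \<noteq> 0" by (simp add: vec_eq_iff)
  then show ?thesis unfolding homogeneous_map_def using homogeneous_form_coord by blast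
qed

text \<open>Rational maps from the projective space with homogeneous coordinates indexed by \<open>'n\<close> to the
  one with homogeneous coordinates indexed by \<open>'m\<close>: in terms of dimensions, from \<open>P\<^sup>r\<close> to \<open>P\<^sup>s\<close>
  where \<open>r + 1\<close> and \<open>s + 1\<close> are the cardinalities of \<open>'n\<close> and \<open>'m\<close>.  So self-maps of the plane
  have type \<open>(3, 3) rational_map\<close>, and maps from the plane to the line \<open>(3, 2) rational_map\<close>.\<close>

quotient_type (overloaded) ('n, 'm) rational_map =
  "complex ^ 'n::finite \<Rightarrow> complex ^ 'm::finite" / partial: same_rational_map
proof (rule part_equivpI)
  have "(vec 1 :: complex ^ 'm) \<noteq> 0" by (simp add: vec_eq_iff)
  then have "same_rational_map (\<lambda>_ :: complex ^ 'n. vec 1 :: complex ^ 'm) (\<lambda>_. vec 1)"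
    unfolding same_rational_map_def by (simp add: homogeneous_map_const)
  then show "\<exists>F :: complex ^ 'n \<Rightarrow> complex ^ 'm. same_rational_map F F" by blast
  show "symp (same_rational_map :: (complex ^ 'n \<Rightarrow> complex ^ 'm) \<Rightarrow> _)"
    by (auto intro: sympI same_rational_map_sym)
  show "transp (same_rational_map :: (complex ^ 'n \<Rightarrow> complex ^ 'm) \<Rightarrow> _)"
    by (auto intro: transpI same_rational_map_trans)
qed

lift_definition represents ::
  "(complex ^ 'n \<Rightarrow> complex ^ 'm) \<Rightarrow> ('n::finite, 'm::finite) rational_map \<Rightarrow> bool"
  is "\<lambda>F G. same_rational_map F G"
  by (metis same_rational_map_sym same_rational_map_trans)

lift_definition id_map :: "('n::finite, 'n) rational_map" is "\<lambda>x. x"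
  unfolding same_rational_map_def by (simp add: homogeneous_map_id)

text \<open>The composite \<open>\<Psi> \<circ> \<Phi>\<close> exists iff the image of \<open>\<Phi>\<close> is not contained in the indeterminacy locus
  of \<open>\<Psi>\<close>, i.e.\ iff substituting some representatives into each other does not give zero.
  If it does not exist, \<open>compose_map \<Psi> \<Phi>\<close> is unspecified.\<close>

definition composable ::
  "('m::finite, 'l::finite) rational_map \<Rightarrow> ('n::finite, 'm) rational_map \<Rightarrow> bool" where
  "composable \<Psi> \<Phi> \<longleftrightarrow> (\<exists>G F. represents G \<Psi> \<and> represents F \<Phi> \<and> (\<exists>x. G (F x) \<noteq> 0))"

definition compose_map ::
  "('m::finite, 'l::finite) rational_map \<Rightarrow> ('n::finite, 'm) rational_map \<Rightarrow> ('n, 'l) rational_map"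
  where
  "compose_map \<Psi> \<Phi> = (THE \<Theta>. \<exists>G F. represents G \<Psi> \<and> represents F \<Phi> \<and> represents (G \<circ> F) \<Theta>)"

primrec iterate_map :: "nat \<Rightarrow> ('n::finite, 'n) rational_map \<Rightarrow> ('n, 'n) rational_map" where
  "iterate_map 0 \<Phi> = id_map"
| "iterate_map (Suc k) \<Phi> = compose_map \<Phi> (iterate_map k \<Phi>)"

definition birational_map :: "('n::finite, 'm::finite) rational_map \<Rightarrow> bool" where
  "birational_map \<Phi> \<longleftrightarrow> (\<exists>\<Psi>. composable \<Psi> \<Phi> \<and> compose_map \<Psi> \<Phi> = id_map \<and>
                            composable \<Phi> \<Psi> \<and> compose_map \<Phi> \<Psi> = id_map)"

text \<open>\<open>\<Phi>\<close> is regular at the point \<open>[x]\<close> if some representative is a well-defined map to projective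
  space near \<open>[x]\<close>; the representative may depend on the point.\<close>

definition regular_at :: "('n::finite, 'm::finite) rational_map \<Rightarrow> complex ^ 'n \<Rightarrow> bool" where
  "regular_at \<Phi> x \<longleftrightarrow> (\<exists>F. represents F \<Phi> \<and> F x \<noteq> 0)"

definition regular_map :: "('n::finite, 'm::finite) rational_map \<Rightarrow> bool" where
  "regular_map \<Phi> \<longleftrightarrow> (\<forall>x. x \<noteq> 0 \<longrightarrow> regular_at \<Phi> x)"

definition constant_map :: "('n::finite, 'm::finite) rational_map \<Rightarrow> bool" where
  "constant_map \<Phi> \<longleftrightarrow> (\<exists>v. represents (\<lambda>_. v) \<Phi>)"

lemma represents_hom: "represents F \<Phi> \<Longrightarrow> homogeneous_map F"
  by transfer (simp add: same_rational_map_def)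

lemma represents_same: "represents F \<Phi> \<Longrightarrow> represents G \<Phi> \<Longrightarrow> same_rational_map F G"
  by transfer (metis same_rational_map_sym same_rational_map_trans)

lemma represents_cong: "same_rational_map F G \<Longrightarrow> represents G \<Phi> \<Longrightarrow> represents F \<Phi>"
  by transfer (metis same_rational_map_trans)

lemma represents_unique: "represents F \<Phi> \<Longrightarrow> represents F \<Psi> \<Longrightarrow> \<Phi> = \<Psi>"
  by transfer (metis same_rational_map_sym same_rational_map_trans)

lemma represents_ex: "homogeneous_map F \<Longrightarrow> \<exists>\<Phi>. represents F \<Phi>"
  by (rule exI[of _ "abs_rational_map F"])
     (simp add: represents.abs_eq same_rational_map_def)

lemma represents_id: "represents (\<lambda>x. x) id_map"
  by transfer (simp add: same_rational_map_def homogeneous_map_id)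

lemma proportional_vectors:
  fixes u v :: "complex ^ 'm"
  assumes "\<And>i j. u $ i * v $ j = u $ j * v $ i" "v \<noteq> 0"
  obtains t where "u = t *s v"
proof -
  obtain k where k: "v $ k \<noteq> 0" using assms(2) by (auto simp: vec_eq_iff)
  have "u = (u $ k / v $ k) *s v"
    using k assms(1)[of _ k] by (auto simp: vec_eq_iff field_simps)
  then show ?thesis by (rule that)
qed

text \<open>The composite does not depend on the representatives, as long as these can be composed.\<close>

lemma same_rational_map_compose:
  assumes GG: "same_rational_map G G'" and FF: "same_rational_map F F'"
    and nz: "G (F x) \<noteq> 0" and nz': "G' (F' x') \<noteq> 0"
  shows "same_rational_map (G \<circ> F) (G' \<circ> F')"
proof -
  have hom: "homogeneous_map (G \<circ> F)" "homogeneous_map (G' \<circ> F')"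
    using GG FF nz nz' homogeneous_map_compose unfolding same_rational_map_def by blast+
  obtain d where d: "\<And>i. homogeneous_form d (\<lambda>x. G x $ i)"
    using GG unfolding same_rational_map_def homogeneous_map_def by blast
  obtain e e' where e: "\<And>i. homogeneous_form e (\<lambda>x. G (F x) $ i)"
    and e': "\<And>i. homogeneous_form e' (\<lambda>x. G' (F' x) $ i)"
    using hom unfolding homogeneous_map_def o_def by blast
  obtain a where a: "\<And>i. homogeneous_form a (\<lambda>x. F' x $ i)"
    using FF unfolding same_rational_map_def homogeneous_map_def by blast
  have "F' x' \<noteq> 0 \<or> F' x' = 0" by simp
  obtain y where "F' y \<noteq> 0" using FF unfolding same_rational_map_def homogeneous_map_def by blast
  then obtain k where k: "F' y $ k \<noteq> 0" by (auto simp: vec_eq_iff)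
  have "G (F z) $ i * G' (F' z) $ j = G (F z) $ j * G' (F' z) $ i" for z i j
  proof -
    have minor: "homogeneous_form (e + e')
        (\<lambda>x. G (F x) $ i * G' (F' x) $ j - (G (F x) $ j * G' (F' x) $ i))"
      by (intro homogeneous_form_minor e e')
    have "(G (F x) $ i * G' (F' x) $ j - (G (F x) $ j * G' (F' x) $ i)) * F' x $ k = 0" for x
    proof (cases "F' x = 0")
      case False
      have "\<And>i j. F x $ i * F' x $ j = F x $ j * F' x $ i"
        using FF unfolding same_rational_map_def by blast
      then obtain t where t: "F x = t *s F' x" using proportional_vectors False by blast
      have "G (F x) $ l = t ^ d * G (F' x) $ l" for l
        unfolding t by (rule homogeneous_form_scale[OF d])
      moreover have "G (F' x) $ i * G' (F' x) $ j = G (F' x) $ j * G' (F' x) $ i"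
        using GG unfolding same_rational_map_def by blast
      ultimately show ?thesis by simp
    qed simp
    from homogeneous_form_zero_product[OF minor a[of k] this k, of z] show ?thesis by simp
  qed
  then show ?thesis using hom unfolding same_rational_map_def o_def by blast
qed

lemma represents_compose_map:
  assumes "represents G \<Psi>" "represents F \<Phi>" "G (F x) \<noteq> 0"
  shows "represents (G \<circ> F) (compose_map \<Psi> \<Phi>)"
proof -
  have "homogeneous_map (G \<circ> F)"
    by (rule homogeneous_map_compose[of G F x])
       (use assms represents_hom[of G \<Psi>] represents_hom[of F \<Phi>] in simp_all)
  from represents_ex[OF this] obtain \<Theta> where \<Theta>: "represents (G \<circ> F) \<Theta>" ..
  have "compose_map \<Psi> \<Phi> = \<Theta>"
    unfolding compose_map_def
  proof (rule the_equality)
    show "\<exists>G F. represents G \<Psi> \<and> represents F \<Phi> \<and> represents (G \<circ> F) \<Theta>"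
      using assms \<Theta> by blast
    fix \<Theta>' assume "\<exists>G F. represents G \<Psi> \<and> represents F \<Phi> \<and> represents (G \<circ> F) \<Theta>'"
    then obtain G' F' where *: "represents G' \<Psi>" "represents F' \<Phi>" "represents (G' \<circ> F') \<Theta>'"
      by blast
    then obtain x' where "G' (F' x') \<noteq> 0"
      using represents_hom[OF *(3)] unfolding homogeneous_map_def by auto
    with same_rational_map_compose[OF represents_same[OF assms(1) *(1)]
        represents_same[OF assms(2) *(2)] assms(3)]
    have "same_rational_map (G \<circ> F) (G' \<circ> F')" .
    from represents_unique[OF represents_cong[OF this *(3)] \<Theta>] show "\<Theta>' = \<Theta>" .
  qed
  then show ?thesis using \<Theta> by simp
qed

end

theory Submission
  imports Defs
    "HOL-Computational_Algebra.Polynomial_Factorial"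
    "HOL-Computational_Algebra.Field_as_Ring"
    "HOL-Computational_Algebra.Fundamental_Theorem_Algebra"
begin

text \<open>The proof has three ingredients.

  First, an invertible morphism of the plane is linear (\<open>invertible_morphism_linear\<close>).
  Because polynomial rings are factorial, a regular map has one representative whose components
  have no common zero apart from the origin (\<open>reduced_representative\<close>). Its degree is \<open>1\<close>, because the
  inverse image of a line is a curve parametrised by the inverse map, and applying the morphism to
  this parametrisation multiplies its degree by that of the morphism and yields the line
  (\<open>degree_of_invertible_morphism\<close>). So \<open>\<Phi>\<^sup>k\<close> is given by an invertible matrix \<open>A\<close>.

  Second, there is no nonconstant rational function invariant under \<open>\<Phi>\<^sup>k\<close> either: the product of
  \<open>g - c\<close> over an orbit segment of length \<open>k\<close> would be \<open>\<Phi>\<close>-invariant, and for a value \<open>c\<close> of \<open>g\<close> it is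
  not constant unless \<open>g\<close> is (\<open>invariant_function_constant\<close>). Hence a rational map into a projective
  space that is invariant under \<open>A\<close> is constant.

  Third, the map \<open>\<Phi>\<close> commutes with \<open>A\<close>. The vectors \<open>x, A x, A\<^sup>2 x\<close> are generically independent,
  since otherwise the vector product of \<open>x\<close> and \<open>A x\<close>, or the identity map, would be a
  nonconstant map invariant under \<open>A\<close> (\<open>cyclic_of_no_invariants\<close>). The coefficients of \<open>\<Phi> x\<close> in this basis
  form an invariant map, so their ratios are constant and \<open>\<Phi>\<close> is a polynomial in \<open>A\<close> of degree at most
  \<open>2\<close>, a linear map (\<open>commuting_map_linear\<close>). Being dominant, it is invertible, hence regular.\<close>

section \<open>Nonzero forms\<close>

text \<open>This is the density of nonempty Zariski open sets. It replaces all talk of general points below: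
  finitely many forms that do not vanish identically are nonzero at a common point.\<close>

lemma forms_common_nonzero:
  fixes p q :: "complex ^ 'n \<Rightarrow> complex"
  assumes "homogeneous_form d p" "homogeneous_form e q" "p x \<noteq> 0" "q y \<noteq> 0"
  shows "\<exists>z. p z \<noteq> 0 \<and> q z \<noteq> 0"
  using homogeneous_form_zero_product[OF assms(1,2) _ assms(4), of x] assms(3)
  by (metis mult_eq_0_iff)

lemma forms_common_nonzero_family:
  fixes p :: "'s \<Rightarrow> complex ^ 'n \<Rightarrow> complex"
  assumes "finite S" "\<And>s. s \<in> S \<Longrightarrow> homogeneous_form (e s) (p s)" "\<And>s. s \<in> S \<Longrightarrow> \<exists>x. p s x \<noteq> 0"
  shows "\<exists>z. \<forall>s\<in>S. p s z \<noteq> 0"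
  using assms
proof (induction S rule: finite_induct)
  case (insert s S)
  have "\<exists>z. \<forall>s\<in>S. p s z \<noteq> 0" by (rule insert.IH) (use insert.prems in auto)
  then obtain z where z: "\<forall>s\<in>S. p s z \<noteq> 0" ..
  have "homogeneous_form (\<Sum>s\<in>S. e s) (\<lambda>x. \<Prod>s\<in>S. p s x)"
    using insert by (intro homogeneous_form_prod) auto
  moreover have "(\<Prod>s\<in>S. p s z) \<noteq> 0" using z insert by simp
  moreover obtain y where "p s y \<noteq> 0" using insert.prems(2)[of s] by auto
  moreover have "homogeneous_form (e s) (p s)" using insert by auto
  ultimately have "\<exists>z. p s z \<noteq> 0 \<and> (\<Prod>s\<in>S. p s z) \<noteq> 0"
    using forms_common_nonzero by blast
  then show ?case using insert by simp
qed simp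

lemma homogeneous_form_cmult:
  "homogeneous_form d p \<Longrightarrow> homogeneous_form d (\<lambda>x. a * p x)"
  using homogeneous_form_mult[OF homogeneous_form_const[of a]] by simp

lemma homogeneous_form_diff:
  "homogeneous_form d p \<Longrightarrow> homogeneous_form d q \<Longrightarrow> homogeneous_form d (\<lambda>x. p x - q x)"
  using homogeneous_form_add[of d p "\<lambda>x. - 1 * q x"] homogeneous_form_cmult[of d q "- 1"] by simp

section \<open>Forms as elements of a factorial ring\<close>

text \<open>The ring \<open>\<complex>[x\<^sub>1, x\<^sub>2, x\<^sub>3]\<close> is encoded as \<open>\<complex>[x\<^sub>1][x\<^sub>2][x\<^sub>3]\<close>, because iterated univariate polynomials form a
  factorial ring by Gauss's lemma. The outermost variable is \<open>x\<^sub>3\<close>.\<close>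

definition eval3 :: "complex poly poly poly \<Rightarrow> complex ^ 3 \<Rightarrow> complex" where
  "eval3 p x = poly (poly (poly p [:[:x $ 3:]:]) [:x $ 2:]) (x $ 1)"

lemma eval3_simps [simp]:
  "eval3 0 x = 0" "eval3 1 x = 1"
  "eval3 (p + q) x = eval3 p x + eval3 q x"
  "eval3 (p - q) x = eval3 p x - eval3 q x"
  "eval3 (p * q) x = eval3 p x * eval3 q x"
  "eval3 (p ^ n) x = eval3 p x ^ n"
  "eval3 [:[:[:a:]:]:] x = a"
  "eval3 [:[:[:0, 1:]:]:] x = x $ 1"
  "eval3 [:[:0, 1:]:] x = x $ 2"
  "eval3 [:0, 1:] x = x $ 3"
  by (simp_all add: eval3_def)

lemma eval3_sum [simp]: "eval3 (\<Sum>i\<in>S. p i) x = (\<Sum>i\<in>S. eval3 (p i) x)"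
  by (induction S rule: infinite_finite_induct) simp_all

lemma eval3_prod [simp]: "eval3 (\<Prod>i\<in>S. p i) x = (\<Prod>i\<in>S. eval3 (p i) x)"
  by (induction S rule: infinite_finite_induct) simp_all

lemma poly_nonzero_at_image:
  fixes p :: "'a::idom poly"
  assumes "p \<noteq> 0" "infinite (range f)"
  shows "\<exists>c. poly p (f c) \<noteq> 0"
proof (rule ccontr)
  assume "\<not> ?thesis"
  then have "range f \<subseteq> {z. poly p z = 0}" by auto
  with poly_roots_finite[OF assms(1)] assms(2) show False using finite_subset by blast
qed

lemma eval3_nonzero:
  assumes "p \<noteq> 0"
  shows "\<exists>x. eval3 p x \<noteq> 0"
proof -
  have inf: "infinite (range (\<lambda>c::complex. [:c:]))" "infinite (range (\<lambda>c::complex. [:[:c:]:]))"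
    by (auto dest!: finite_imageD simp: inj_on_def infinite_UNIV_char_0)
  obtain c where c: "poly p [:[:c:]:] \<noteq> 0" using poly_nonzero_at_image[OF assms inf(2)] by blast
  obtain b where b: "poly (poly p [:[:c:]:]) [:b:] \<noteq> 0"
    using poly_nonzero_at_image[OF c inf(1)] by blast
  obtain a where a: "poly (poly (poly p [:[:c:]:]) [:b:]) a \<noteq> 0"
    using b poly_all_0_iff_0 by blast
  have "eval3 p (vector [a, b, c]) \<noteq> 0" using a by (simp add: eval3_def)
  then show ?thesis by blast
qed

lemma eval3_eq_iff: "(\<forall>x. eval3 p x = eval3 q x) \<longleftrightarrow> p = q"
  using eval3_nonzero[of "p - q"] by fastforce

lemma form_eq_eval3:
  assumes "homogeneous_form d f"
  shows "\<exists>p. f = eval3 p"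
proof -
  obtain c where f: "f = (\<lambda>x. \<Sum>\<alpha> | (\<Sum>i\<in>UNIV. \<alpha> i) = d. c \<alpha> * (\<Prod>i\<in>UNIV. (x $ i) ^ \<alpha> i))"
    using assms unfolding homogeneous_form_def by blast
  define X :: "3 \<Rightarrow> complex poly poly poly" where
    "X = (\<lambda>i. if i = 1 then [:[:[:0, 1:]:]:] else if i = 2 then [:[:0, 1:]:] else [:0, 1:])"
  have X: "eval3 (X i) x = x $ i" for i x using exhaust_3[of i] by (auto simp: X_def)
  show ?thesis unfolding f
    by (rule exI[of _ "\<Sum>\<alpha> | (\<Sum>i\<in>UNIV. \<alpha> i) = d. [:[:[:c \<alpha>:]:]:] * (\<Prod>i\<in>UNIV. X i ^ \<alpha> i)"])
      (rule ext, simp only: eval3_simps eval3_sum eval3_prod X)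
qed

text \<open>These are the polynomial functions, graded by degree.\<close>

definition sum_of_forms :: "(complex ^ 'n \<Rightarrow> complex) \<Rightarrow> bool" where
  "sum_of_forms f \<longleftrightarrow>
     (\<exists>N g. (\<forall>j. homogeneous_form j (g j)) \<and> (\<forall>x. f x = (\<Sum>j\<le>N. g j x)))"

lemma sum_of_forms_form:
  assumes "homogeneous_form d f" shows "sum_of_forms f"
  unfolding sum_of_forms_def
  by (rule exI[of _ d], rule exI[of _ "\<lambda>j. if j = d then f else (\<lambda>_. 0)"])
    (auto simp: assms homogeneous_form_0 if_distrib[of "\<lambda>h. h _"])

lemma sum_of_forms_add:
  assumes "sum_of_forms f" "sum_of_forms g"
  shows "sum_of_forms (\<lambda>x. f x + g x)"
proof -
  obtain N u where u: "\<And>j. homogeneous_form j (u j)" "\<And>x. f x = (\<Sum>j\<le>N. u j x)"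
    using assms(1) unfolding sum_of_forms_def by blast
  obtain M v where v: "\<And>j. homogeneous_form j (v j)" "\<And>x. g x = (\<Sum>j\<le>M. v j x)"
    using assms(2) unfolding sum_of_forms_def by blast
  define w where "w = (\<lambda>j x. (if j \<le> N then u j x else 0) + (if j \<le> M then v j x else 0))"
  have "homogeneous_form j (w j)" for j
    unfolding w_def using u(1)[of j] v(1)[of j]
    by (intro homogeneous_form_add) (cases "j \<le> N"; cases "j \<le> M"; simp add: homogeneous_form_0)+
  moreover have "f x + g x = (\<Sum>j\<le>max N M. w j x)" for x
  proof -
    have "f x = (\<Sum>j\<le>max N M. if j \<le> N then u j x else 0)"
      unfolding u by (rule sum.mono_neutral_cong_left) auto
    moreover have "g x = (\<Sum>j\<le>max N M. if j \<le> M then v j x else 0)"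
      unfolding v by (rule sum.mono_neutral_cong_left) auto
    ultimately show ?thesis by (simp add: w_def sum.distrib)
  qed
  ultimately show ?thesis unfolding sum_of_forms_def by blast
qed

lemma sum_of_forms_coord_mult:
  assumes "sum_of_forms f"
  shows "sum_of_forms (\<lambda>x. x $ i * f x)"
proof -
  obtain N u where u: "\<And>j. homogeneous_form j (u j)" "\<And>x. f x = (\<Sum>j\<le>N. u j x)"
    using assms(1) unfolding sum_of_forms_def by blast
  define w where "w = (\<lambda>j x. case j of 0 \<Rightarrow> 0 | Suc j \<Rightarrow> x $ i * u j x)"
  have "homogeneous_form j (w j)" for j
    using homogeneous_form_mult[OF homogeneous_form_coord u(1)]
    by (cases j) (auto simp: w_def homogeneous_form_0)
  moreover have "x $ i * f x = (\<Sum>j\<le>Suc N. w j x)" for x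
    by (subst sum.atMost_Suc_shift) (simp add: w_def u sum_distrib_left)
  ultimately show ?thesis unfolding sum_of_forms_def by blast
qed

lemma sum_of_forms_eval3: "sum_of_forms (eval3 p)"
proof -
  have 1: "sum_of_forms (eval3 [:[:p:]:])" for p
  proof (induction p)
    case (pCons a p)
    have "eval3 [:[:pCons a p:]:] = (\<lambda>x. a + x $ 1 * eval3 [:[:p:]:] x)"
      by (simp add: eval3_def fun_eq_iff)
    then show ?case
      using sum_of_forms_add[OF sum_of_forms_form[OF homogeneous_form_const]
          sum_of_forms_coord_mult[OF pCons.IH]] by simp
  qed (use sum_of_forms_form[OF homogeneous_form_0] in \<open>simp add: eval3_def\<close>)
  have 2: "sum_of_forms (eval3 [:p:])" for p
  proof (induction p)
    case (pCons a p)
    have "eval3 [:pCons a p:] = (\<lambda>x. eval3 [:[:a:]:] x + x $ 2 * eval3 [:p:] x)"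
      by (simp add: eval3_def fun_eq_iff)
    then show ?case
      using sum_of_forms_add[OF 1 sum_of_forms_coord_mult[OF pCons.IH]] by simp
  qed (use sum_of_forms_form[OF homogeneous_form_0] in \<open>simp add: eval3_def\<close>)
  show ?thesis
  proof (induction p)
    case (pCons a p)
    have "eval3 (pCons a p) = (\<lambda>x. eval3 [:a:] x + x $ 3 * eval3 p x)"
      by (simp add: eval3_def fun_eq_iff)
    then show ?case
      using sum_of_forms_add[OF 2 sum_of_forms_coord_mult[OF pCons.IH]] by simp
  qed (use sum_of_forms_form[OF homogeneous_form_0] in \<open>simp add: eval3_def\<close>)
qed

lemma sum_of_forms_on_ray:
  assumes u: "\<And>j. homogeneous_form j (u j)" and f: "\<And>x. f x = (\<Sum>j\<le>N. u j x)"
  shows "poly (\<Sum>j\<le>N. monom (u j x) j) t = f (t *s x)"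
  by (simp add: f poly_sum poly_monom homogeneous_form_scale[OF u] mult.commute)

text \<open>A divisor of \<open>c t\<^sup>D\<close> has no root apart from \<open>0\<close>, so it is a power of \<open>t\<close> times a polynomial without
  roots, which is constant.\<close>

lemma divisor_of_monom:
  fixes P Q :: "complex poly"
  assumes "P * Q = monom c D" "c \<noteq> 0"
  shows "\<exists>n b. P = monom b n"
proof -
  have P0: "P \<noteq> 0" using assms by auto
  define n where "n = order 0 P"
  obtain R where R: "P = [:0, 1:] ^ n * R" "poly R 0 \<noteq> 0"
    using order_decomp[OF P0, of 0] by (auto simp: n_def poly_eq_0_iff_dvd)
  have "poly R z \<noteq> 0" for z
  proof
    assume z: "poly R z = 0"
    then have "poly (monom c D) z = 0" by (simp add: R flip: assms(1))
    then have "z = 0" using assms(2) by (simp add: poly_monom)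
    with z R(2) show False by simp
  qed
  then have "degree R = 0"
    using fundamental_theorem_of_algebra constant_degree by blast
  then obtain b where "R = [:b:]" by (rule degree_eq_zeroE)
  then have "P = monom b n" by (simp add: R(1) monom_altdef)
  then show ?thesis by blast
qed

text \<open>Restricted to a ray \<open>t \<mapsto> t x\<close>, the product of \<open>f\<close> and \<open>g\<close> is a monomial in \<open>t\<close>, so \<open>f\<close> is a monomial there.
  If \<open>f\<close> had two nonzero homogeneous components, then a ray on which neither of them vanishes
  would contradict this.\<close>

lemma factor_of_form_is_form:
  fixes f g :: "complex ^ 'n \<Rightarrow> complex"
  assumes f: "sum_of_forms f" and g: "sum_of_forms g"
    and fg: "homogeneous_form D (\<lambda>x. f x * g x)" and y: "f y * g y \<noteq> 0"
  shows "\<exists>d. homogeneous_form d f"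
proof -
  obtain N u where u: "\<And>j. homogeneous_form j (u j)" "\<And>x. f x = (\<Sum>j\<le>N. u j x)"
    using f unfolding sum_of_forms_def by blast
  obtain M v where v: "\<And>j. homogeneous_form j (v j)" "\<And>x. g x = (\<Sum>j\<le>M. v j x)"
    using g unfolding sum_of_forms_def by blast
  define U where "U = (\<lambda>x. \<Sum>j\<le>N. monom (u j x) j)"
  define V where "V = (\<lambda>x. \<Sum>j\<le>M. monom (v j x) j)"
  have U: "poly (U x) t = f (t *s x)" for x t
    unfolding U_def by (rule sum_of_forms_on_ray[OF u])
  have V: "poly (V x) t = g (t *s x)" for x t
    unfolding V_def by (rule sum_of_forms_on_ray[OF v])
  have coeff_U: "coeff (U x) j = u j x" if "j \<le> N" for j x
    using that by (simp add: U_def coeff_sum)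
  have UV: "U x * V x = monom (f x * g x) D" for x
    by (rule poly_ext)
      (simp add: U V poly_monom homogeneous_form_scale[OF fg] mult.commute)
  obtain a x0 where a: "a \<le> N" "u a x0 \<noteq> 0"
  proof (rule ccontr)
    assume "\<not> thesis"
    then have "f y = 0" using that by (simp add: u(2)) (metis (mono_tags) atMost_iff sum.neutral)
    then show False using y by simp
  qed
  have "u b x = 0" if b: "b \<le> N" "b \<noteq> a" for b x
  proof (rule ccontr)
    assume "u b x \<noteq> 0"
    from forms_common_nonzero[OF u(1) u(1) this a(2)]
    obtain z where z: "u b z \<noteq> 0 \<and> u a z \<noteq> 0" by blast
    have ab: "homogeneous_form (b + a) (\<lambda>x. u b x * u a x)" by (intro homogeneous_form_mult u)
    obtain w where w: "u b w * u a w \<noteq> 0" "f w * g w \<noteq> 0"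
      using forms_common_nonzero[OF ab fg, of z y] z y by auto
    obtain n c where "U w = monom c n" using divisor_of_monom[OF UV w(2)] by blast
    then have "u a w = (if a = n then c else 0)" "u b w = (if b = n then c else 0)"
      using coeff_U[OF a(1), of w] coeff_U[OF b(1), of w] by auto
    then show False using w(1) b(2) by (auto split: if_splits)
  qed
  then have "f x = u a x" for x
    unfolding u(2) using a(1) by (subst sum.remove[of _ a]) auto
  then have "f = u a" by blast
  with u(1) show ?thesis by auto
qed

lemma divide_out_Gcd:
  fixes p :: "'i \<Rightarrow> 'a :: {semiring_Gcd, idom}"
  assumes "p i0 \<noteq> 0"
  shows "\<exists>g q. g \<noteq> 0 \<and> (\<forall>i. p i = g * q i) \<and> Gcd (range q) = 1"
proof -
  define g where "g = Gcd (range p)"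
  define q where "q = (\<lambda>i. p i div g)"
  have g0: "g \<noteq> 0" using assms by (auto simp: g_def Gcd_0_iff)
  have pq: "p i = g * q i" for i by (simp add: g_def q_def Gcd_dvd)
  have "g = Gcd ((*) g ` range q)"
    unfolding image_image pq[symmetric] by (simp add: g_def)
  also have "\<dots> = normalize (g * Gcd (range q))" by (rule Gcd_mult)
  finally have "g * Gcd (range q) dvd g * 1" by (metis mult.right_neutral normalize_dvd_iff dvd_refl)
  then have "is_unit (Gcd (range q))" using g0 by (subst (asm) dvd_mult_cancel_left) simp
  then have "Gcd (range q) = 1" by (metis is_unit_normalize normalize_Gcd)
  with g0 pq show ?thesis by blast
qed

text \<open>If \<open>q j \<noteq> 0\<close>, then \<open>q j\<close> divides \<open>h j * q i = h i * q j\<close> for all \<open>i\<close>, hence it divides the greatest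
  common divisor \<open>h j\<close> of these products. The quotient is the factor sought.\<close>

lemma proportional_to_coprime:
  fixes q h :: "'i \<Rightarrow> 'a :: {semiring_Gcd, idom}"
  assumes "Gcd (range q) = 1" and par: "\<And>i j. h i * q j = h j * q i"
  shows "\<exists>c. \<forall>i. h i = c * q i"
proof -
  obtain j where j: "q j \<noteq> 0"
  proof (rule ccontr)
    assume "\<not> thesis"
    then have "range q \<subseteq> {0}" using that by blast
    then have "Gcd (range q) = 0" by (simp add: Gcd_0_iff)
    with assms show False by simp
  qed
  have "q j dvd Gcd ((*) (h j) ` range q)"
  proof (rule Gcd_greatest)
    fix b assume "b \<in> (*) (h j) ` range q"
    then obtain i where "b = h j * q i" by blast
    then show "q j dvd b" using par[of j i] by (metis dvd_triv_right)
  qed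
  then have "q j dvd h j" by (simp add: Gcd_mult assms)
  then obtain c where c: "h j = q j * c" ..
  have "h i = c * q i" for i
  proof -
    have "h i * q j = (c * q i) * q j" using par[of i j] c by (simp add: mult_ac)
    then show ?thesis using j by simp
  qed
  then show ?thesis by blast
qed

text \<open>Dividing the components of a representative by their greatest common divisor gives a
  representative of which every other one is a multiple. So it is nonzero wherever the map is
  regular: a map that is regular everywhere has a single representative without nontrivial zeros.\<close>

lemma reduced_representative:
  fixes F :: "complex ^ 3 \<Rightarrow> complex ^ 'm"
  assumes F: "homogeneous_map F"
  shows "\<exists>F'. same_rational_map F' F \<and> (\<forall>H x. same_rational_map H F \<and> H x \<noteq> 0 \<longrightarrow> F' x \<noteq> 0)"
proof -
  obtain d where d: "\<And>i. homogeneous_form d (\<lambda>x. F x $ i)"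
    using F unfolding homogeneous_map_def by blast
  obtain i0 x0 where i0: "F x0 $ i0 \<noteq> 0"
    using F unfolding homogeneous_map_def by (auto simp: vec_eq_iff)
  have "\<forall>i. \<exists>p. (\<lambda>x. F x $ i) = eval3 p" using form_eq_eval3[OF d] by blast
  then obtain p where p: "\<And>i x. F x $ i = eval3 (p i) x" by metis
  have "p i0 \<noteq> 0" using i0 p by force
  from divide_out_Gcd[of p, OF this] obtain g q
    where gq: "g \<noteq> 0" "\<And>i. p i = g * q i" "Gcd (range q) = 1" by blast
  obtain F' :: "complex ^ 3 \<Rightarrow> complex ^ 'm" where F': "\<And>x i. F' x $ i = eval3 (q i) x"
    using that[of "\<lambda>x. \<chi> i. eval3 (q i) x"] by simp
  have FF': "F x $ i = eval3 g x * F' x $ i" for x i by (simp add: p gq F')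
  have "\<exists>e. homogeneous_form e (eval3 g)"
    using d[of i0] i0 FF' F'
    by (intro factor_of_form_is_form[of _ "eval3 (q i0)" d x0] sum_of_forms_eval3) auto
  then obtain e where e: "homogeneous_form e (eval3 g)" ..
  have *: "homogeneous_form (d - e) (\<lambda>x. F' x $ i)" for i
  proof (cases "q i = 0")
    case True
    then show ?thesis by (simp add: F' homogeneous_form_0)
  next
    case False
    then have "g * q i \<noteq> 0" using gq by simp
    then obtain y where "eval3 (g * q i) y \<noteq> 0" using eval3_nonzero by blast
    then have y: "eval3 g y * eval3 (q i) y \<noteq> 0" by simp
    have "\<exists>e. homogeneous_form e (eval3 (q i))"
      using d[of i] y FF' F'
      by (intro factor_of_form_is_form[of _ "eval3 g" d y] sum_of_forms_eval3) (auto simp: mult_ac)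
    then obtain e' where e': "homogeneous_form e' (eval3 (q i))" ..
    \<comment> \<open>Comparing the values at \<open>y\<close> and \<open>2 y\<close> determines the degree of \<open>q i\<close>.\<close>
    have "eval3 g (2 *s y) * eval3 (q i) (2 *s y) = 2 ^ d * (eval3 g y * eval3 (q i) y)"
      using homogeneous_form_scale[OF d[of i], of 2 y] by (simp add: FF' F')
    then have "(2::complex) ^ (e + e') = 2 ^ d"
      using y by (simp add: homogeneous_form_scale[OF e] homogeneous_form_scale[OF e'] power_add)
    then have "(of_nat (2 ^ (e + e')) :: complex) = of_nat (2 ^ d)" by simp
    then have "(2::nat) ^ (e + e') = 2 ^ d" by (rule of_nat_eq_iff[THEN iffD1])
    then have "e + e' = d" by (rule power_inject_exp[THEN iffD1, rotated]) simp
    then have "e' = d - e" by simp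
    with e' show ?thesis by (simp add: F')
  qed
  have "F' x0 $ i0 \<noteq> 0" using i0 FF' by auto
  then have "F' x0 \<noteq> 0" by auto
  with * have hom: "homogeneous_map F'" unfolding homogeneous_map_def by blast
  have "same_rational_map F' F"
    unfolding same_rational_map_def using F hom FF' by (simp add: mult.left_commute mult.commute)
  moreover have "F' x \<noteq> 0" if H: "same_rational_map H F" "H x \<noteq> 0" for H x
  proof -
    have HF': "same_rational_map H F'"
      using H(1) same_rational_map_sym[OF calculation] same_rational_map_trans by blast
    then obtain n where n: "\<And>i. homogeneous_form n (\<lambda>x. H x $ i)"
      unfolding same_rational_map_def homogeneous_map_def by blast
    have "\<forall>i. \<exists>p. (\<lambda>x. H x $ i) = eval3 p" using form_eq_eval3[OF n] by blast
    then obtain h where h: "\<And>i x. H x $ i = eval3 (h i) x" by metis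
    have "h i * q j = h j * q i" for i j
    proof -
      have "eval3 (h i * q j) x = eval3 (h j * q i) x" for x
        using HF' unfolding same_rational_map_def by (simp add: h F')
      then show ?thesis using eval3_eq_iff by blast
    qed
    from proportional_to_coprime[OF gq(3) this] obtain c where "\<And>i. h i = c * q i" by blast
    then have "H x $ i = eval3 c x * F' x $ i" for i by (simp add: h F')
    then show ?thesis using H(2) by (auto simp: vec_eq_iff)
  qed
  ultimately show ?thesis by blast
qed

section \<open>Linearity of invertible morphisms\<close>

lemma coeff_mult_degree_bounds:
  fixes p q :: "'a::comm_semiring_0 poly"
  assumes "degree p \<le> m" "degree q \<le> n"
  shows "coeff (p * q) (m + n) = coeff p m * coeff q n"
proof -
  have "coeff p i * coeff q (m + n - i) = 0" if "i \<noteq> m" "i \<le> m + n" for i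
    using that assms by (cases "i < m") (auto simp: coeff_eq_0)
  then have "(\<Sum>i\<le>m + n. coeff p i * coeff q (m + n - i)) = (\<Sum>i\<in>{m}. coeff p i * coeff q (m + n - i))"
    by (intro sum.mono_neutral_right) auto
  then show ?thesis by (simp add: coeff_mult)
qed

lemma coeff_power_degree_bound:
  fixes p :: "'a::comm_semiring_1 poly"
  assumes "degree p \<le> n"
  shows "degree (p ^ k) \<le> n * k \<and> coeff (p ^ k) (n * k) = coeff p n ^ k"
proof (induction k)
  case (Suc k)
  then have "degree (p * p ^ k) \<le> n + n * k"
    using degree_mult_le[of p "p ^ k"] assms by linarith
  with Suc show ?case using coeff_mult_degree_bounds[OF assms, of "p ^ k" "n * k"] by simp
qed simp

lemma coeff_prod_degree_bounds:
  fixes p :: "'i \<Rightarrow> 'a::comm_semiring_1 poly"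
  assumes "\<And>i. i \<in> S \<Longrightarrow> degree (p i) \<le> n i"
  shows "degree (\<Prod>i\<in>S. p i) \<le> (\<Sum>i\<in>S. n i) \<and>
    coeff (\<Prod>i\<in>S. p i) (\<Sum>i\<in>S. n i) = (\<Prod>i\<in>S. coeff (p i) (n i))"
  using assms
proof (induction S rule: infinite_finite_induct)
  case (insert i S)
  then have IH: "degree (prod p S) \<le> sum n S" "coeff (prod p S) (sum n S) = (\<Prod>i\<in>S. coeff (p i) (n i))"
    and i: "degree (p i) \<le> n i" by auto
  have "degree (p i * prod p S) \<le> n i + sum n S"
    using degree_mult_le[of "p i" "prod p S"] i IH by linarith
  with insert(1,2) IH show ?case using coeff_mult_degree_bounds[OF i IH(1)] by simp
qed simp_all

text \<open>Substituting polynomials of degree at most \<open>n\<close> into a form of degree \<open>d\<close> gives a polynomial of degree at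
  most \<open>n * d\<close>; its top coefficient is the form evaluated at the top coefficients, which is the
  value at the point at infinity of the parametrised curve.\<close>

lemma form_substitute_polys:
  fixes f :: "complex ^ 'n \<Rightarrow> complex" and q :: "'n \<Rightarrow> complex poly"
  assumes "homogeneous_form d f" and q: "\<And>i. degree (q i) \<le> n"
  shows "\<exists>P. (\<forall>t. poly P t = f (\<chi> i. poly (q i) t)) \<and> degree P \<le> n * d \<and>
    coeff P (n * d) = f (\<chi> i. coeff (q i) n)"
proof -
  obtain c where f: "f = (\<lambda>x. \<Sum>\<alpha> | (\<Sum>i\<in>UNIV. \<alpha> i) = d. c \<alpha> * (\<Prod>i\<in>UNIV. (x $ i) ^ \<alpha> i))"
    using assms(1) unfolding homogeneous_form_def by blast
  define P where "P = (\<Sum>\<alpha> | (\<Sum>i\<in>UNIV. \<alpha> i) = d. smult (c \<alpha>) (\<Prod>i\<in>UNIV. q i ^ \<alpha> i))"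
  have monomial: "degree (\<Prod>i\<in>UNIV. q i ^ \<alpha> i) \<le> n * d \<and>
      coeff (\<Prod>i\<in>UNIV. q i ^ \<alpha> i) (n * d) = (\<Prod>i\<in>UNIV. coeff (q i) n ^ \<alpha> i)"
    if "(\<Sum>i\<in>UNIV. \<alpha> i) = d" for \<alpha> :: "'n \<Rightarrow> nat"
    using coeff_prod_degree_bounds[of UNIV "\<lambda>i. q i ^ \<alpha> i" "\<lambda>i. n * \<alpha> i"]
      coeff_power_degree_bound[OF q] that by (simp flip: sum_distrib_left)
  have "degree P \<le> n * d"
    unfolding P_def
    by (intro degree_sum_le finite_exponents order.trans[OF degree_smult_le]) (use monomial in auto)
  moreover have "coeff P (n * d) = f (\<chi> i. coeff (q i) n)"
    unfolding P_def f coeff_sum by (intro sum.cong) (use monomial in auto)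
  moreover have "poly P t = f (\<chi> i. poly (q i) t)" for t
    by (simp add: P_def f poly_sum poly_prod)
  ultimately show ?thesis by blast
qed

lemma form_nonzero_at_nonzero:
  fixes p :: "complex ^ 'n \<Rightarrow> complex"
  assumes "homogeneous_form d p" "p x \<noteq> 0"
  shows "\<exists>z. p z \<noteq> 0 \<and> z $ i \<noteq> 0"
  by (rule forms_common_nonzero[OF assms(1) homogeneous_form_coord assms(2), where y = "axis i 1"])
    (simp add: axis_def)

lemma coprime_polys_no_common_root:
  fixes q :: "'i \<Rightarrow> complex poly"
  assumes "Gcd (range q) = 1"
  shows "\<exists>i. poly (q i) t \<noteq> 0"
proof (rule ccontr)
  assume "\<not> ?thesis"
  then have "[:- t, 1:] dvd Gcd (range q)" by (intro Gcd_greatest) (auto simp: poly_eq_0_iff_dvd)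
  with assms have "[:- t, 1:] dvd 1" by simp
  then have "degree [:- t, 1:] \<le> degree (1 :: complex poly)" by (rule dvd_imp_degree_le) simp
  then show False by simp
qed

text \<open>The right inverse \<open>G\<close> maps a line in the target to a curve. After common factors are removed,
  this curve is parametrised by coprime polynomials \<open>q i\<close> of some degree \<open>n\<close>. Since \<open>L\<close> has no nontrivial
  zero, \<open>L\<close> of the parametrisation has degree exactly \<open>d * n\<close> and no common root. But it is
  proportional to the parametrisation of the line, so it is a constant multiple of it and has
  degree \<open>1\<close>. Hence \<open>d * n = 1\<close>.\<close>

lemma degree_of_invertible_morphism:
  fixes L G :: "complex ^ 3 \<Rightarrow> complex ^ 3"
  assumes L: "\<And>i. homogeneous_form d (\<lambda>x. L x $ i)" and L_nz: "\<And>x. x \<noteq> 0 \<Longrightarrow> L x \<noteq> 0"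
    and G: "homogeneous_map G" and LG: "same_rational_map (L \<circ> G) (\<lambda>x. x)"
  shows "d = 1"
proof -
  obtain e where e: "\<And>i. homogeneous_form e (\<lambda>x. G x $ i)"
    using G unfolding homogeneous_map_def by blast
  obtain i0 x0 where "G x0 $ i0 \<noteq> 0"
    using G unfolding homogeneous_map_def by (auto simp: vec_eq_iff)
  \<comment> \<open>On the line through \<open>y\<close> in the second coordinate direction the first coordinate is the nonzero
    constant \<open>y $ 1\<close>, so proportionality can be divided by it.\<close>
  from form_nonzero_at_nonzero[OF e this, of 1]
  obtain y where y: "G y $ i0 \<noteq> 0" "y $ 1 \<noteq> 0" by blast
  have "\<forall>i. \<exists>P. \<forall>t. poly P t = G (y + t *s axis 2 1) $ i"
    using homogeneous_form_on_line[OF e] by blast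
  then obtain p where p: "\<And>i t. poly (p i) t = G (y + t *s axis 2 1) $ i" by metis
  have "p i0 \<noteq> 0" using p[of i0 0] y by auto
  from divide_out_Gcd[of p, OF this] obtain g q
    where gq: "g \<noteq> 0" "\<And>i. p i = g * q i" "Gcd (range q) = 1" by blast
  define n where "n = Max (range (\<lambda>i. degree (q i)))"
  have n: "degree (q i) \<le> n" for i by (simp add: n_def)
  have "n \<in> range (\<lambda>i. degree (q i))" unfolding n_def by (intro Max_in) auto
  then obtain m where m: "degree (q m) = n" by blast
  have q0: "\<exists>i. coeff (q i) n \<noteq> 0"
  proof (cases "q m = 0")
    case True
    obtain i where "poly (q i) 0 \<noteq> 0" using coprime_polys_no_common_root[OF gq(3)] by blast
    moreover have "n = 0" using True m by simp
    ultimately show ?thesis by (auto simp: poly_0_coeff_0)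
  qed (use m in \<open>auto intro: exI[of _ m]\<close>)
  have "\<forall>i. \<exists>P. (\<forall>t. poly P t = L (\<chi> i. poly (q i) t) $ i) \<and> degree P \<le> n * d \<and>
    coeff P (n * d) = L (\<chi> i. coeff (q i) n) $ i"
    using form_substitute_polys[where q = q, OF L n] by blast
  then obtain Q where Q: "\<And>i t. poly (Q i) t = L (\<chi> i. poly (q i) t) $ i"
    "\<And>i. degree (Q i) \<le> n * d" "\<And>i. coeff (Q i) (n * d) = L (\<chi> i. coeff (q i) n) $ i" by metis
  have Q_nz: "\<exists>i. poly (Q i) t \<noteq> 0" for t
  proof -
    have "(\<chi> i. poly (q i) t) \<noteq> 0"
      using coprime_polys_no_common_root[OF gq(3)] by (auto simp: vec_eq_iff)
    from L_nz[OF this] show ?thesis by (auto simp: Q vec_eq_iff)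
  qed
  define r where "r = Q 1"
  have Qr: "smult (y $ 1) (Q i) = r * [:y $ i, if i = 2 then 1 else 0:]" for i
  proof -
    \<comment> \<open>The factor \<open>g ^ d\<close> accounts for the common factor removed from \<open>G\<close> on the line.\<close>
    have "poly (g ^ d * (smult (y $ 1) (Q i) - r * [:y $ i, if i = 2 then 1 else 0:])) t = 0" for t
    proof -
      let ?x = "y + t *s axis 2 1"
      have "G ?x = poly g t *s (\<chi> i. poly (q i) t)"
        using p gq(2) by (simp add: vec_eq_iff flip: p)
      then have LGx: "L (G ?x) $ j = poly g t ^ d * poly (Q j) t" for j
        using homogeneous_form_scale[OF L, of "poly g t"] by (simp add: Q)
      have "L (G ?x) $ i * ?x $ 1 = L (G ?x) $ 1 * ?x $ i"
        using LG unfolding same_rational_map_def o_apply by blast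
      then show ?thesis unfolding LGx
        by (cases "i = 2") (simp_all add: r_def axis_def algebra_simps)
    qed
    then have "g ^ d * (smult (y $ 1) (Q i) - r * [:y $ i, if i = 2 then 1 else 0:]) = 0"
      using poly_all_0_iff_0 by blast
    then show ?thesis using gq(1) by simp
  qed
  have "poly r t \<noteq> 0" for t
  proof
    assume r: "poly r t = 0"
    obtain i where i: "poly (Q i) t \<noteq> 0" using Q_nz by blast
    have "y $ 1 * poly (Q i) t = poly (smult (y $ 1) (Q i)) t" by simp
    also have "\<dots> = 0" unfolding Qr by (simp add: r)
    finally show False using i y(2) by simp
  qed
  then have deg_r: "degree r = 0" "r \<noteq> 0"
    using fundamental_theorem_of_algebra constant_degree by (blast, force)
  have deg_Q: "degree (Q i) \<le> 1" for i
  proof -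
    have "degree (Q i) = degree (smult (y $ 1) (Q i))" using y(2) by simp
    also have "\<dots> \<le> degree r + degree [:y $ i, if i = 2 then 1 else 0:]"
      unfolding Qr by (rule degree_mult_le)
    also have "\<dots> \<le> 1" using deg_r by simp
    finally show ?thesis .
  qed
  have "degree (smult (y $ 1) (Q 2)) = 1"
    unfolding Qr using deg_r by (subst degree_mult_eq) auto
  then have "1 \<le> n * d" using Q(2)[of 2] y(2) by simp
  moreover have "n * d \<le> 1"
  proof -
    have "(\<chi> i. coeff (q i) n) \<noteq> 0" using q0 by (auto simp: vec_eq_iff)
    from L_nz[OF this] obtain i where "coeff (Q i) (n * d) \<noteq> 0" by (auto simp: Q vec_eq_iff)
    then have "n * d \<le> degree (Q i)" by (rule le_degree)
    with deg_Q[of i] show ?thesis by linarith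
  qed
  ultimately have "n * d = 1" by (rule antisym[rotated])
  then show ?thesis by simp
qed

lemma linear_form_expand:
  fixes p :: "complex ^ 'n \<Rightarrow> complex"
  assumes "homogeneous_form 1 p"
  shows "\<exists>a. \<forall>x. p x = (\<Sum>i\<in>UNIV. a i * x $ i)"
proof -
  obtain c where p: "p = (\<lambda>x. \<Sum>\<alpha> | (\<Sum>i\<in>UNIV. \<alpha> i) = 1. c \<alpha> * (\<Prod>i\<in>UNIV. (x $ i) ^ \<alpha> i))"
    using assms unfolding homogeneous_form_def by blast
  define u :: "'n \<Rightarrow> 'n \<Rightarrow> nat" where "u = (\<lambda>i j. if j = i then 1 else 0)"
  have exps: "{\<alpha> :: 'n \<Rightarrow> nat. (\<Sum>i\<in>UNIV. \<alpha> i) = 1} = range u"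
  proof (intro set_eqI iffI)
    fix \<alpha> :: "'n \<Rightarrow> nat" assume "\<alpha> \<in> {\<alpha>. (\<Sum>i\<in>UNIV. \<alpha> i) = 1}"
    then obtain i where "\<alpha> i = Suc 0" "\<forall>j\<in>UNIV. i \<noteq> j \<longrightarrow> \<alpha> j = 0"
      using sum_eq_1_iff[of UNIV \<alpha>] by auto
    then have "\<alpha> = u i" by (auto simp: u_def)
    then show "\<alpha> \<in> range u" by blast
  qed (auto simp: u_def)
  have inj: "inj u" by (rule injI) (metis u_def zero_neq_one)
  have prod: "(\<Prod>j\<in>UNIV. (x $ j) ^ u i j) = x $ i" for x :: "complex ^ 'n" and i
  proof -
    have "(\<Prod>j\<in>UNIV. (x $ j) ^ u i j) = (\<Prod>j\<in>UNIV. if j = i then x $ i else 1)"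
      by (intro prod.cong) (auto simp: u_def)
    then show ?thesis by simp
  qed
  have "p x = (\<Sum>i\<in>UNIV. c (u i) * x $ i)" for x
    unfolding p exps by (simp add: sum.reindex[OF inj] prod)
  then show ?thesis by (intro exI[of _ "\<lambda>i. c (u i)"]) simp
qed

lemma linear_forms_matrix:
  fixes L :: "complex ^ 'n \<Rightarrow> complex ^ 'm"
  assumes "\<And>i. homogeneous_form 1 (\<lambda>x. L x $ i)"
  shows "\<exists>A. \<forall>x. L x = A *v x"
proof -
  have "\<forall>i. \<exists>a. \<forall>x. L x $ i = (\<Sum>j\<in>UNIV. a j * x $ j)" using linear_form_expand[OF assms] by blast
  then obtain a where "\<And>i x. L x $ i = (\<Sum>j\<in>UNIV. a i j * x $ j)" by metis
  then have "L x = (\<chi> i j. a i j) *v x" for x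
    by (simp add: vec_eq_iff matrix_vector_mult_def)
  then show ?thesis by blast
qed

lemma matrix_vector_forms: "homogeneous_form 1 (\<lambda>x. (A *v x) $ i)"
  unfolding matrix_vector_mult_def vec_lambda_beta
  by (intro homogeneous_form_sum homogeneous_form_cmult homogeneous_form_coord)

section \<open>Dominant maps and their iterates\<close>

text \<open>The image is contained in no hypersurface.\<close>

definition dominant :: "(complex ^ 'n \<Rightarrow> complex ^ 'm) \<Rightarrow> bool" where
  "dominant F \<longleftrightarrow> (\<forall>d q. homogeneous_form d q \<longrightarrow> (\<exists>y. q y \<noteq> 0) \<longrightarrow> (\<exists>x. q (F x) \<noteq> 0))"

lemma dominantD: "dominant F \<Longrightarrow> homogeneous_form d q \<Longrightarrow> q y \<noteq> 0 \<Longrightarrow> \<exists>x. q (F x) \<noteq> 0"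
  unfolding dominant_def by blast

lemma homogeneous_map_forms: "homogeneous_map F \<Longrightarrow> \<exists>d. \<forall>i. homogeneous_form d (\<lambda>x. F x $ i)"
  unfolding homogeneous_map_def by blast

lemma homogeneous_map_nonzero: "homogeneous_map F \<Longrightarrow> \<exists>i x. F x $ i \<noteq> 0"
  unfolding homogeneous_map_def by (auto simp: vec_eq_iff)

lemma homogeneous_mapI: "(\<And>i. homogeneous_form d (\<lambda>x. F x $ i)) \<Longrightarrow> F x $ i \<noteq> 0 \<Longrightarrow> homogeneous_map F"
  unfolding homogeneous_map_def by (metis zero_index)

lemma dominant_nonzero:
  assumes "dominant F" "homogeneous_map G"
  shows "\<exists>x. G (F x) \<noteq> 0"
proof -
  obtain d where d: "\<And>i. homogeneous_form d (\<lambda>x. G x $ i)" using homogeneous_map_forms[OF assms(2)] by blast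
  obtain i y where "G y $ i \<noteq> 0" using homogeneous_map_nonzero[OF assms(2)] by blast
  from dominantD[OF assms(1) d this] show ?thesis by (metis zero_index)
qed

lemma dominant_cong:
  fixes F G :: "complex ^ 'n \<Rightarrow> complex ^ 'm"
  assumes FG: "same_rational_map F G" and "dominant F"
  shows "dominant G"
  unfolding dominant_def
proof (intro allI impI)
  fix d and q :: "complex ^ 'm \<Rightarrow> complex"
  assume q: "homogeneous_form d q" "\<exists>y. q y \<noteq> 0"
  have hom: "homogeneous_map F" "homogeneous_map G" using FG by (auto simp: same_rational_map_def)
  obtain a b where a: "\<And>i. homogeneous_form a (\<lambda>x. F x $ i)" and b: "\<And>i. homogeneous_form b (\<lambda>x. G x $ i)"
    using hom homogeneous_map_forms by metis
  obtain i y where y: "G y $ i \<noteq> 0" using homogeneous_map_nonzero hom by blast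
  obtain x where x: "q (F x) \<noteq> 0" using dominantD[OF assms(2) q(1)] q(2) by blast
  obtain z where z: "q (F z) \<noteq> 0" "G z $ i \<noteq> 0"
    using forms_common_nonzero[OF homogeneous_form_compose[OF q(1) a] b x y] by blast
  have "G z \<noteq> 0" using z(2) by auto
  moreover have "\<And>i j. F z $ i * G z $ j = F z $ j * G z $ i" using FG by (simp add: same_rational_map_def)
  ultimately obtain t where "F z = t *s G z" using proportional_vectors by blast
  then have "q (F z) = t ^ d * q (G z)" using homogeneous_form_scale[OF q(1)] by simp
  then show "\<exists>x. q (G x) \<noteq> 0" using z(1) by auto
qed

text \<open>If \<open>F (G z)\<close> is a nonzero multiple of \<open>z\<close> and \<open>q z \<noteq> 0\<close>, then \<open>q\<close> is nonzero at \<open>F (G z)\<close>.\<close>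

lemma dominant_of_right_inverse:
  fixes F :: "complex ^ 'n \<Rightarrow> complex ^ 'm"
  assumes FG: "same_rational_map (F \<circ> G) (\<lambda>x. x)"
  shows "dominant F"
  unfolding dominant_def
proof (intro allI impI)
  fix d and q :: "complex ^ 'm \<Rightarrow> complex"
  assume q: "homogeneous_form d q" "\<exists>y. q y \<noteq> 0"
  have hom: "homogeneous_map (F \<circ> G)" using FG by (auto simp: same_rational_map_def)
  obtain a where a: "\<And>i. homogeneous_form a (\<lambda>x. (F \<circ> G) x $ i)"
    using homogeneous_map_forms[OF hom] by blast
  obtain i y where y: "(F \<circ> G) y $ i \<noteq> 0" using homogeneous_map_nonzero[OF hom] by blast
  obtain z where z: "q z \<noteq> 0" "(F \<circ> G) z $ i \<noteq> 0"
    using forms_common_nonzero[OF q(1) a] y q(2) by blast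
  have "(F \<circ> G) z \<noteq> 0" using z(2) by auto
  moreover have "\<And>i j. z $ i * (F \<circ> G) z $ j = z $ j * (F \<circ> G) z $ i"
    using FG by (simp add: same_rational_map_def mult.commute)
  ultimately obtain t where "z = t *s (F \<circ> G) z" using proportional_vectors by blast
  then have "q z = t ^ d * q ((F \<circ> G) z)" using homogeneous_form_scale[OF q(1)] by metis
  then show "\<exists>x. q (F x) \<noteq> 0" using z(1) by auto
qed

lemma dominant_compose:
  fixes F :: "complex ^ 'n \<Rightarrow> complex ^ 'm"
  assumes "dominant F" "dominant G" "homogeneous_map F"
  shows "dominant (F \<circ> G)"
  unfolding dominant_def
proof (intro allI impI)
  fix d and q :: "complex ^ 'm \<Rightarrow> complex"
  assume q: "homogeneous_form d q" "\<exists>y. q y \<noteq> 0"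
  obtain a where a: "\<And>i. homogeneous_form a (\<lambda>x. F x $ i)"
    using homogeneous_map_forms[OF assms(3)] by blast
  obtain y where y: "q (F y) \<noteq> 0" using dominantD[OF assms(1) q(1)] q(2) by blast
  show "\<exists>x. q ((F \<circ> G) x) \<noteq> 0"
    using dominantD[OF assms(2) homogeneous_form_compose[OF q(1) a] y] by simp
qed

lemma same_rational_map_refl: "homogeneous_map F \<Longrightarrow> same_rational_map F F"
  unfolding same_rational_map_def by (simp add: mult.commute)

lemma same_rational_map_homogeneous:
  "same_rational_map F G \<Longrightarrow> homogeneous_map F" "same_rational_map F G \<Longrightarrow> homogeneous_map G"
  by (simp_all add: same_rational_map_def)

lemma same_rational_map_compose_dominant:
  assumes "same_rational_map G G'" "same_rational_map F F'" "dominant F"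
  shows "same_rational_map (G \<circ> F) (G' \<circ> F')"
proof -
  obtain x where "G (F x) \<noteq> 0"
    using dominant_nonzero[OF assms(3)] same_rational_map_homogeneous(1)[OF assms(1)] by blast
  moreover obtain x' where "G' (F' x') \<noteq> 0"
    using dominant_nonzero[OF dominant_cong[OF assms(2,3)]] same_rational_map_homogeneous(2)[OF assms(1)] by blast
  ultimately show ?thesis using same_rational_map_compose assms(1,2) by blast
qed

lemma dominant_id: "dominant (\<lambda>x. x)"
  unfolding dominant_def by blast

lemma iterate_dominant:
  fixes F :: "complex ^ 'n \<Rightarrow> complex ^ 'n"
  assumes "homogeneous_map F" "dominant F"
  shows "homogeneous_map (F ^^ k) \<and> dominant (F ^^ k)"
proof (induction k)
  case 0
  show ?case unfolding funpow.simps id_def using homogeneous_map_id dominant_id by blast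
next
  case (Suc k)
  obtain x where "F ((F ^^ k) x) \<noteq> 0" using dominant_nonzero Suc assms(1) by blast
  with Suc have "homogeneous_map (F \<circ> F ^^ k)" using homogeneous_map_compose[OF assms(1)] by blast
  then show ?case unfolding funpow.simps using Suc dominant_compose[OF assms(2) _ assms(1)] by blast
qed

lemma represents_iterate:
  assumes "represents F \<Phi>" "dominant F"
  shows "represents (F ^^ k) (iterate_map k \<Phi>)"
proof (induction k)
  case 0
  show ?case unfolding funpow.simps id_def iterate_map.simps by (rule represents_id)
next
  case (Suc k)
  have "homogeneous_map F" using represents_hom[OF assms(1)] .
  then obtain x where "F ((F ^^ k) x) \<noteq> 0"
    using dominant_nonzero iterate_dominant assms(2) by blast
  from represents_compose_map[OF assms(1) Suc this] show ?case by (simp only: funpow.simps iterate_map.simps)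
qed

lemma iterate_right_inverse:
  fixes F R :: "complex ^ 'n \<Rightarrow> complex ^ 'n"
  assumes F: "homogeneous_map F" "dominant F" and R: "homogeneous_map R" "dominant R"
    and FR: "same_rational_map (F \<circ> R) (\<lambda>x. x)"
  shows "same_rational_map (F ^^ k \<circ> R ^^ k) (\<lambda>x. x)"
proof (induction k)
  case 0
  show ?case unfolding funpow.simps comp_id unfolding id_def by (rule same_rational_map_refl[OF homogeneous_map_id])
next
  case (Suc k)
  note Fk = iterate_dominant[OF F, of k] and Rk = iterate_dominant[OF R, of k]
  have Rk': "same_rational_map (R ^^ k) (R ^^ k)" and Fk': "same_rational_map (F ^^ k) (F ^^ k)"
    using Fk Rk same_rational_map_refl by blast+
  have 1: "same_rational_map ((F \<circ> R) \<circ> R ^^ k) ((\<lambda>x. x) \<circ> R ^^ k)"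
    by (rule same_rational_map_compose_dominant[OF FR Rk']) (use Rk in blast)
  have "dominant ((F \<circ> R) \<circ> R ^^ k)"
    by (rule dominant_cong[OF same_rational_map_sym[OF 1]]) (use Rk in \<open>simp add: comp_def\<close>)
  from same_rational_map_compose_dominant[OF Fk' 1 this]
  have "same_rational_map (F ^^ k \<circ> ((F \<circ> R) \<circ> R ^^ k)) (F ^^ k \<circ> ((\<lambda>x. x) \<circ> R ^^ k))" .
  moreover have "F ^^ k \<circ> ((F \<circ> R) \<circ> R ^^ k) = F ^^ Suc k \<circ> R ^^ Suc k"
    by (simp only: funpow_Suc_right comp_assoc) (simp only: funpow.simps flip: funpow_Suc_right)
  moreover have "F ^^ k \<circ> ((\<lambda>x. x) \<circ> R ^^ k) = F ^^ k \<circ> R ^^ k" by (simp add: comp_def)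
  ultimately show ?case using Suc same_rational_map_trans by metis
qed

text \<open>The two composites in the definition of birationality may come from different representatives
  of the inverse. Dominance does not depend on the representative, so one pair serves for both.\<close>

lemma birational_representatives:
  assumes "birational_map \<Phi>"
  shows "\<exists>F R. represents F \<Phi> \<and> dominant F \<and> homogeneous_map R \<and> dominant R \<and>
    same_rational_map (F \<circ> R) (\<lambda>x. x)"
proof -
  obtain \<Psi> where \<Psi>: "composable \<Psi> \<Phi>" "compose_map \<Psi> \<Phi> = id_map"
    "composable \<Phi> \<Psi>" "compose_map \<Phi> \<Psi> = id_map"
    using assms unfolding birational_map_def by blast
  obtain R' F' x' where 1: "represents R' \<Psi>" "represents F' \<Phi>" "R' (F' x') \<noteq> 0"
    using \<Psi>(1) unfolding composable_def by blast
  obtain F R x where 2: "represents F \<Phi>" "represents R \<Psi>" "F (R x) \<noteq> 0"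
    using \<Psi>(3) unfolding composable_def by blast
  have "same_rational_map (R' \<circ> F') (\<lambda>x. x)"
    using represents_same[OF represents_compose_map[OF 1]] \<Psi>(2) represents_id by simp
  then have "dominant R" by (rule dominant_cong[OF represents_same[OF 1(1) 2(2)] dominant_of_right_inverse])
  moreover have FR: "same_rational_map (F \<circ> R) (\<lambda>x. x)"
    using represents_same[OF represents_compose_map[OF 2]] \<Psi>(4) represents_id by simp
  ultimately show ?thesis
    using dominant_of_right_inverse[OF FR] 2(1) represents_hom[OF 2(2)] by blast
qed

section \<open>Invariant rational functions\<close>

text \<open>The function \<open>g = A / B\<close> is invariant under the \<open>k\<close>-th iterate, so for each constant \<open>c\<close> the product
  of \<open>g - c\<close> over the first \<open>k\<close> points of an orbit is invariant under \<open>\<Phi>\<close> itself, since \<open>\<Phi>\<close> permutes the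
  factors cyclically. By hypothesis this product is constant. If \<open>c\<close> is a value of \<open>g\<close>, the product
  vanishes somewhere, so it vanishes identically; then one factor does, and \<open>g = c\<close> by dominance.
  The product is written as \<open>[P : Q]\<close> with \<open>P\<close> and \<open>Q\<close> forms of the same degree.\<close>

lemma invariant_function_constant:
  fixes F :: "complex ^ 3 \<Rightarrow> complex ^ 3" and A B :: "complex ^ 3 \<Rightarrow> complex"
  assumes F: "represents F \<Phi>" "dominant F" and "k \<ge> 1"
    and no_inv: "\<not> (\<exists>f :: (3, 2) rational_map. \<not> constant_map f \<and> composable f \<Phi> \<and> compose_map f \<Phi> = f)"
    and A: "homogeneous_form d A" and B: "homogeneous_form d B" and B0: "B y \<noteq> 0"
    and inv: "\<And>x. A ((F ^^ k) x) * B x = B ((F ^^ k) x) * A x"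
  shows "\<exists>c. \<forall>x. A x = c * B x"
proof -
  have hF: "homogeneous_map F" using represents_hom[OF F(1)] .
  have "\<forall>i. \<exists>e. \<forall>j. homogeneous_form e (\<lambda>x. (F ^^ i) x $ j)"
    using iterate_dominant[OF hF F(2)] homogeneous_map_forms by blast
  then obtain e where e: "\<And>i j. homogeneous_form (e i) (\<lambda>x. (F ^^ i) x $ j)" by metis
  have iter: "homogeneous_form (e i * d) (\<lambda>x. p ((F ^^ i) x))" if "homogeneous_form d p" for p i
    using homogeneous_form_compose[OF that e] .
  have orbit_nonzero: "\<exists>z. \<forall>i\<in>{..<k}. p ((F ^^ i) z) \<noteq> 0" if "homogeneous_form d p" "p x \<noteq> 0" for p x
    by (rule forms_common_nonzero_family[where e = "\<lambda>i. e i * d"])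
      (use iter dominantD[OF _ that] iterate_dominant[OF hF F(2)] that in blast)+
  obtain x0 where x0: "\<forall>i\<in>{..<k}. B ((F ^^ i) x0) \<noteq> 0" using orbit_nonzero[OF B B0] by blast
  have B_x0: "B x0 \<noteq> 0" using x0 \<open>k \<ge> 1\<close> by (auto dest: bspec[of _ _ 0])
  \<comment> \<open>The denominator \<open>Q\<close> is nonzero at \<open>x0\<close>, so \<open>P / Q\<close> has a genuine zero there.\<close>
  define c where "c = A x0 / B x0"
  define p where "p = (\<lambda>x. A x - c * B x)"
  have p: "homogeneous_form d p"
    unfolding p_def by (intro homogeneous_form_diff A homogeneous_form_cmult B)
  define P Q where "P = (\<lambda>x. \<Prod>i<k. p ((F ^^ i) x))" and "Q = (\<lambda>x. \<Prod>i<k. B ((F ^^ i) x))"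
  define h :: "complex ^ 3 \<Rightarrow> complex ^ 2" where "h = (\<lambda>x. vector [P x, Q x])"
  have PQ: "homogeneous_form (\<Sum>i<k. e i * d) P" "homogeneous_form (\<Sum>i<k. e i * d) Q"
    unfolding P_def Q_def by (intro homogeneous_form_prod iter p B finite_lessThan)+
  have "homogeneous_form (\<Sum>i<k. e i * d) (\<lambda>x. h x $ i)" for i
    using PQ exhaust_2[of i] by (auto simp: h_def)
  moreover have Q_x0: "Q x0 \<noteq> 0" using x0 by (simp add: Q_def)
  then have "h x0 $ 2 \<noteq> 0" by (simp add: h_def)
  ultimately have h: "homogeneous_map h" by (rule homogeneous_mapI)
  have hF0: "\<exists>x. h (F x) \<noteq> 0" by (rule dominant_nonzero[OF F(2) h])
  have "P (F x) * Q x = Q (F x) * P x" for x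
  proof -
    obtain l where l: "k = Suc l" using \<open>k \<ge> 1\<close> by (cases k) auto
    have first: "(\<Prod>i<k. f ((F ^^ i) x)) = f x * (\<Prod>i<l. f ((F ^^ Suc i) x))" for f :: "_ \<Rightarrow> complex"
      unfolding l by (subst prod.lessThan_Suc_shift) simp
    have last: "(\<Prod>i<k. f ((F ^^ i) (F x))) = (\<Prod>i<l. f ((F ^^ Suc i) x)) * f ((F ^^ k) x)"
      for f :: "_ \<Rightarrow> complex"
      unfolding l by (simp add: funpow_swap1)
    have "p ((F ^^ k) x) * B x = B ((F ^^ k) x) * p x"
      using inv[of x] by (simp add: p_def algebra_simps)
    then show ?thesis unfolding P_def Q_def first last by (simp add: mult_ac)
  qed
  then have "same_rational_map (h \<circ> F) h"
    using homogeneous_map_compose[OF h hF] hF0 h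
    unfolding same_rational_map_def forall_2 by (auto simp: h_def mult_ac)
  moreover obtain f where f: "represents h f" using represents_ex[OF h] by blast
  ultimately have "represents (h \<circ> F) f" by (rule represents_cong)
  moreover obtain x1 where "h (F x1) \<noteq> 0" using hF0 by blast
  from represents_compose_map[OF f F(1) this] have "represents (h \<circ> F) (compose_map f \<Phi>)" .
  ultimately have "compose_map f \<Phi> = f" by (metis represents_unique)
  moreover have "composable f \<Phi>" using f F(1) hF0 unfolding composable_def by blast
  ultimately have "constant_map f" using no_inv by blast
  then obtain v where v: "represents (\<lambda>_. v) f" unfolding constant_map_def by blast
  have v0: "v \<noteq> 0" using represents_hom[OF v] unfolding homogeneous_map_def by simp
  have Pv: "P x * v $ 2 = Q x * v $ 1" for x
  proof -
    have "h x $ 1 * v $ 2 = h x $ 2 * v $ 1"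
      using represents_same[OF f v] unfolding same_rational_map_def by blast
    then show ?thesis by (simp add: h_def)
  qed
  have "P x0 = 0"
  proof -
    have "p ((F ^^ 0) x0) = 0" using B_x0 by (simp add: p_def c_def)
    moreover have "0 \<in> {..<k}" using \<open>k \<ge> 1\<close> by simp
    ultimately show ?thesis unfolding P_def by (intro prod_zero bexI[of _ 0]) auto
  qed
  then have v1: "v $ 1 = 0" using Pv[of x0] Q_x0 by simp
  then have "v $ 2 \<noteq> 0" using v0 by (auto simp: vec_eq_iff forall_2)
  then have P0: "P x = 0" for x using Pv[of x] v1 by simp
  have "p x = 0" for x
  proof (rule ccontr)
    assume "p x \<noteq> 0"
    from orbit_nonzero[OF p this] have "\<exists>z. \<forall>i\<in>{..<k}. p ((F ^^ i) z) \<noteq> 0" .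
    then show False using P0 by (auto simp: P_def)
  qed
  then show ?thesis by (auto simp: p_def)
qed

text \<open>All quotients of components of an invariant map are invariant functions, hence constant.\<close>

lemma invariant_map_constant:
  fixes F :: "complex ^ 3 \<Rightarrow> complex ^ 3" and K :: "complex ^ 3 \<Rightarrow> complex ^ 'm"
  assumes F: "represents F \<Phi>" "dominant F" and "k \<ge> 1"
    and no_inv: "\<not> (\<exists>f :: (3, 2) rational_map. \<not> constant_map f \<and> composable f \<Phi> \<and> compose_map f \<Phi> = f)"
    and inv: "same_rational_map (K \<circ> F ^^ k) K"
  shows "\<exists>j v. \<forall>x. K x = K x $ j *s v"
proof -
  have K: "homogeneous_map K" using inv by (simp add: same_rational_map_def)
  obtain d where d: "\<And>i. homogeneous_form d (\<lambda>x. K x $ i)" using homogeneous_map_forms[OF K] by blast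
  obtain j y where y: "K y $ j \<noteq> 0" using homogeneous_map_nonzero[OF K] by blast
  have "\<exists>c. \<forall>x. K x $ i = c * K x $ j" for i
    by (rule invariant_function_constant[where A = "\<lambda>x. K x $ i" and B = "\<lambda>x. K x $ j",
          OF F \<open>k \<ge> 1\<close> no_inv d d y])
      (use inv in \<open>simp add: same_rational_map_def\<close>)
  then have "\<exists>v. \<forall>i x. K x $ i = v i * K x $ j" by (intro choice allI)
  then obtain v where v: "\<forall>i x. K x $ i = v i * K x $ j" ..
  have "K x = K x $ j *s (\<chi> i. v i)" for x
  proof (unfold vec_eq_iff, rule allI)
    fix i
    have "K x $ i = v i * K x $ j" using v by blast
    then show "K x $ i = (K x $ j *s (\<chi> i. v i)) $ i" by (simp add: mult.commute)
  qed
  then show ?thesis by blast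
qed

section \<open>Maps commuting with a linear automorphism\<close>

text \<open>The complex analogues of the vector product and of the scalar triple product, the latter being
  the determinant of three vectors.\<close>

definition cross :: "complex ^ 3 \<Rightarrow> complex ^ 3 \<Rightarrow> complex ^ 3" where
  "cross u v = vector [u $ 2 * v $ 3 - u $ 3 * v $ 2, u $ 3 * v $ 1 - u $ 1 * v $ 3,
     u $ 1 * v $ 2 - u $ 2 * v $ 1]"

definition triple :: "complex ^ 3 \<Rightarrow> complex ^ 3 \<Rightarrow> complex ^ 3 \<Rightarrow> complex" where
  "triple u v w = (\<Sum>i\<in>UNIV. u $ i * cross v w $ i)"

lemmas triple_expand = triple_def cross_def sum_3

lemma triple_eq_det: "triple u v w = det (vector [u, v, w])"
  by (simp add: triple_expand det_3 algebra_simps)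

lemma triple_scale:
  "triple (s *s u) v w = s * triple u v w" "triple u (s *s v) w = s * triple u v w"
  "triple u v (s *s w) = s * triple u v w"
  by (simp_all add: triple_expand algebra_simps)

lemma triple_matrix: "triple (A *v u) (A *v v) (A *v w) = det A * triple u v w"
proof -
  have "(vector [A *v u, A *v v, A *v w] :: complex ^ 3 ^ 3) = vector [u, v, w] ** transpose A"
    by (simp add: vec_eq_iff forall_3 matrix_matrix_mult_def matrix_vector_mult_def transpose_def
        sum_3 mult.commute)
  then show ?thesis by (simp add: triple_eq_det det_mul mult.commute)
qed

text \<open>Cramer's rule: the coordinates of \<open>x\<close> with respect to \<open>u, v, w\<close>, without denominators.\<close>

lemma triple_Cramer:
  "triple u v w *s x = triple x v w *s u + triple u x w *s v + triple u v x *s w"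
  by (simp add: vec_eq_iff forall_3 triple_expand algebra_simps)

lemma cross_cross_triple: "cross (cross u v) (cross v w) = triple u v w *s v"
  by (simp add: vec_eq_iff forall_3 triple_expand algebra_simps)

lemma cross_eq_0_iff: "cross u v = 0 \<longleftrightarrow> (\<forall>i j. u $ i * v $ j = u $ j * v $ i)"
  by (auto simp: vec_eq_iff forall_3 cross_def mult.commute)

lemma dot_cross_self: "(\<Sum>i\<in>UNIV. u $ i * cross u v $ i) = 0"
  by (simp add: sum_3 cross_def algebra_simps)


lemma cross_form:
  assumes "\<And>i. homogeneous_form a (\<lambda>x. u x $ i)" "\<And>i. homogeneous_form b (\<lambda>x. v x $ i)"
  shows "homogeneous_form (a + b) (\<lambda>x. cross (u x) (v x) $ i)"
  using exhaust_3[of i] homogeneous_form_minor[OF assms assms]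
  by (auto simp: cross_def)

lemma triple_form:
  assumes "\<And>i. homogeneous_form a (\<lambda>x. u x $ i)" "\<And>i. homogeneous_form b (\<lambda>x. v x $ i)"
    "\<And>i. homogeneous_form c (\<lambda>x. w x $ i)"
  shows "homogeneous_form (a + (b + c)) (\<lambda>x. triple (u x) (v x) (w x))"
  unfolding triple_def by (intro homogeneous_form_sum homogeneous_form_mult cross_form assms)

lemma linear_square_forms:
  "homogeneous_form 1 (\<lambda>x. (A *v (A *v x)) $ i)" for A :: "complex ^ 'n ^ 'n"
  using matrix_vector_forms[of "A ** A" i] by (simp only: matrix_vector_mul_assoc)

text \<open>If \<open>x, A x, A\<^sup>2 x\<close> are always dependent, then the plane spanned by \<open>x\<close> and \<open>A x\<close> contains \<open>A\<^sup>2 x\<close>, so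
  its normal vector \<open>K x\<close>, the vector product of \<open>x\<close> and \<open>A x\<close>, is an invariant map. If \<open>K\<close> is not
  identically zero, it has by hypothesis a fixed direction \<open>v\<close>, and \<open>K x\<close> being orthogonal to \<open>x\<close> forces
  \<open>v\<close> to be orthogonal to all vectors. If \<open>K\<close> is identically zero, then \<open>A\<close> acts as the identity on the
  projective plane and the identity map is invariant, but it has no fixed direction.\<close>

lemma cyclic_of_no_invariants:
  fixes A :: "complex ^ 3 ^ 3"
  assumes inv: "\<And>K :: complex ^ 3 \<Rightarrow> complex ^ 3. homogeneous_map K \<Longrightarrow>
      (\<And>x i j. K (A *v x) $ i * K x $ j = K (A *v x) $ j * K x $ i) \<Longrightarrow> \<exists>j v. \<forall>x. K x = K x $ j *s v"
  shows "\<exists>x. triple x (A *v x) (A *v (A *v x)) \<noteq> 0"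
proof (rule ccontr)
  assume "\<not> ?thesis"
  then have triple0: "triple x (A *v x) (A *v (A *v x)) = 0" for x by blast
  define K where "K = (\<lambda>x. cross x (A *v x))"
  have K_forms: "homogeneous_form (1 + 1) (\<lambda>x. K x $ i)" for i
    unfolding K_def by (intro cross_form homogeneous_form_coord matrix_vector_forms)
  show False
  proof (cases "\<exists>y m. K y $ m \<noteq> 0")
    case True
    then obtain y m where y: "K y $ m \<noteq> 0" by blast
    have "homogeneous_map K" by (rule homogeneous_mapI[OF K_forms y])
    moreover have "K (A *v x) $ i * K x $ j = K (A *v x) $ j * K x $ i" for x i j
    proof -
      have "cross (K x) (K (A *v x)) = 0"
        unfolding K_def cross_cross_triple triple0 by simp
      then show ?thesis unfolding cross_eq_0_iff by (metis mult.commute)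
    qed
    ultimately obtain j v where v: "\<And>x. K x = K x $ j *s v" using inv by meson
    have y': "K y $ j \<noteq> 0" using y v[of y] by (metis mult_zero_left vector_smult_component)
    define q :: "complex ^ 3 \<Rightarrow> complex" where "q = (\<lambda>x. \<Sum>i\<in>UNIV. v $ i * x $ i)"
    have q: "homogeneous_form 1 q"
      unfolding q_def by (intro homogeneous_form_sum homogeneous_form_cmult homogeneous_form_coord)
    have "q x * K x $ j = 0" for x
    proof -
      have "q x * K x $ j = (\<Sum>i\<in>UNIV. x $ i * (K x $ j *s v) $ i)"
        unfolding q_def sum_distrib_right by (simp add: mult_ac)
      also have "\<dots> = 0"
        unfolding v[of x, symmetric] unfolding K_def by (rule dot_cross_self)
      finally show ?thesis .
    qed
    from homogeneous_form_zero_product[OF q K_forms this y'] have "q (axis m 1) = 0" .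
    then have "v $ m = 0" by (simp add: q_def axis_def if_distrib[of "\<lambda>a. _ * a"] cong: if_cong)
    then have "K y $ m = 0" using v[of y] by (metis mult_zero_right vector_smult_component)
    then show False using y by contradiction
  next
    case False
    then have "K x = 0" for x by (simp add: vec_eq_iff)
    then have "(A *v x) $ i * x $ j = (A *v x) $ j * x $ i" for x i j
      unfolding K_def cross_eq_0_iff by (metis mult.commute)
    then obtain j v where v: "\<And>x :: complex ^ 3. x = x $ j *s v"
      using inv[OF homogeneous_map_id] by meson
    obtain m :: 3 where m: "m \<noteq> j" by (metis zero_neq_one)
    have "axis m (1 :: complex) = 0" using v[of "axis m 1"] m by (simp add: axis_def)
    then show False by (simp add: axis_eq_0_iff)
  qed
qed

text \<open>Expand \<open>F x = a\<^sub>1 x + a\<^sub>2 A x + a\<^sub>3 A\<^sup>2 x\<close> in the generic basis \<open>x, A x, A\<^sup>2 x\<close>. As \<open>A\<close> is linear and commutes with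
  the map, applying \<open>A\<close> to \<open>x\<close> multiplies all the coefficients \<open>a\<^sub>1, a\<^sub>2, a\<^sub>3\<close> by one common factor. So their
  ratios are invariant, hence constant, and up to a scalar function the map is given by a
  polynomial in \<open>A\<close>. In the proof \<open>\<alpha>\<close> is the triple of coefficients multiplied by the determinant \<open>D\<close>
  of the basis.\<close>

lemma commuting_map_linear:
  fixes A :: "complex ^ 3 ^ 3" and F :: "complex ^ 3 \<Rightarrow> complex ^ 3"
  assumes F: "homogeneous_map F" and A_nz: "\<And>x. x \<noteq> 0 \<Longrightarrow> A *v x \<noteq> 0"
    and comm: "\<And>x i j. F (A *v x) $ i * (A *v F x) $ j = F (A *v x) $ j * (A *v F x) $ i"
    and inv: "\<And>K :: complex ^ 3 \<Rightarrow> complex ^ 3. homogeneous_map K \<Longrightarrow>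
      (\<And>x i j. K (A *v x) $ i * K x $ j = K (A *v x) $ j * K x $ i) \<Longrightarrow> \<exists>j v. \<forall>x. K x = K x $ j *s v"
  shows "\<exists>N. same_rational_map (\<lambda>x. N *v x) F"
proof -
  obtain d where d: "\<And>i. homogeneous_form d (\<lambda>x. F x $ i)" using homogeneous_map_forms[OF F] by blast
  obtain m y0 where y0: "F y0 $ m \<noteq> 0" using homogeneous_map_nonzero[OF F] by blast
  note forms = homogeneous_form_coord matrix_vector_forms linear_square_forms d
  define D where "D = (\<lambda>x. triple x (A *v x) (A *v (A *v x)))"
  have D: "homogeneous_form (1 + (1 + 1)) D"
    unfolding D_def by (intro triple_form forms)
  obtain y1 where "D y1 \<noteq> 0" unfolding D_def using cyclic_of_no_invariants[OF inv] by blast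
  from forms_common_nonzero[OF D d this y0] obtain z where z: "D z \<noteq> 0" "F z $ m \<noteq> 0" by blast
  define \<alpha> :: "complex ^ 3 \<Rightarrow> complex ^ 3" where
    "\<alpha> = (\<lambda>x. vector [triple (F x) (A *v x) (A *v (A *v x)), triple x (F x) (A *v (A *v x)),
       triple x (A *v x) (F x)])"
  have Cramer: "D x *s F x = \<alpha> x $ 1 *s x + \<alpha> x $ 2 *s (A *v x) + \<alpha> x $ 3 *s (A *v (A *v x))" for x
    unfolding D_def \<alpha>_def vector_3 by (rule triple_Cramer)
  have "homogeneous_form (d + 2) (\<lambda>x. \<alpha> x $ i)" for i
  proof -
    have "homogeneous_form (d + (1 + 1)) (\<lambda>x. \<alpha> x $ 1)" "homogeneous_form (1 + (d + 1)) (\<lambda>x. \<alpha> x $ 2)"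
      "homogeneous_form (1 + (1 + d)) (\<lambda>x. \<alpha> x $ 3)"
      unfolding \<alpha>_def vector_3 by (intro triple_form forms)+
    then show ?thesis using exhaust_3[of i] by (auto simp: eval_nat_numeral)
  qed
  moreover have "\<exists>i. \<alpha> z $ i \<noteq> 0"
  proof (rule ccontr)
    assume "\<not> ?thesis"
    then have "D z *s F z = 0" unfolding Cramer by simp
    then have "D z * F z $ m = 0" by (metis vector_smult_component zero_index)
    then show False using z by simp
  qed
  ultimately have \<alpha>_hom: "homogeneous_map \<alpha>" using homogeneous_mapI by blast
  have "\<alpha> (A *v x) $ i * \<alpha> x $ j = \<alpha> (A *v x) $ j * \<alpha> x $ i" for x i j
  proof (cases "F x = 0")
    case True
    have "\<alpha> x = 0"
      unfolding \<alpha>_def True by (simp add: vec_eq_iff forall_3 triple_expand)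
    then show ?thesis by simp
  next
    case False
    from A_nz[OF this] obtain s where s: "F (A *v x) = s *s (A *v F x)"
      using proportional_vectors[OF comm] by blast
    have "\<alpha> (A *v x) $ i = s * det A * \<alpha> x $ i" for i
      using exhaust_3[of i] by (auto simp: \<alpha>_def s triple_scale triple_matrix)
    then show ?thesis by simp
  qed
  from inv[OF \<alpha>_hom this] obtain j v where v: "\<And>x. \<alpha> x = \<alpha> x $ j *s v" by blast
  define n where "n = (\<lambda>x. v $ 1 *s x + v $ 2 *s (A *v x) + v $ 3 *s (A *v (A *v x)))"
  have n: "homogeneous_form 1 (\<lambda>x. n x $ i)" for i
    unfolding n_def vector_add_component vector_smult_component
    by (intro homogeneous_form_add homogeneous_form_cmult forms)
  obtain N where N: "n = (\<lambda>x. N *v x)" using linear_forms_matrix[OF n] by blast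
  have Dn: "D x * F x $ i = \<alpha> x $ j * n x $ i" for x i
  proof -
    have comp: "\<alpha> x $ l = \<alpha> x $ j * v $ l" for l
      using v[of x] by (metis vector_smult_component)
    have "D x *s F x = \<alpha> x $ j *s n x"
      unfolding Cramer comp[of 1] comp[of 2] comp[of 3] n_def
      by (simp add: vec_eq_iff algebra_simps)
    then show ?thesis by (metis vector_smult_component)
  qed
  have "n z $ m \<noteq> 0" using z Dn[of z m] by auto
  from homogeneous_mapI[OF n this] have n_hom: "homogeneous_map n" .
  have "n x $ i * F x $ l = n x $ l * F x $ i" for x i l
  proof -
    have minor: "homogeneous_form (1 + d) (\<lambda>x. n x $ i * F x $ l - n x $ l * F x $ i)"
      by (intro homogeneous_form_minor n d)
    have "(n x $ i * F x $ l - n x $ l * F x $ i) * D x = 0" for x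
    proof -
      have "(n x $ i * F x $ l - n x $ l * F x $ i) * D x =
          n x $ i * (D x * F x $ l) - n x $ l * (D x * F x $ i)" by (simp add: algebra_simps)
      also have "\<dots> = 0" unfolding Dn by simp
      finally show ?thesis .
    qed
    from homogeneous_form_zero_product[OF minor D this z(1), of x] show ?thesis by simp
  qed
  then have "same_rational_map n F" using n_hom F unfolding same_rational_map_def by blast
  then show ?thesis unfolding N by blast
qed

text \<open>If \<open>N\<close> were singular, its image would lie in a hyperplane, given by a kernel vector of the
  transpose.\<close>

lemma dominant_linear_nowhere_zero:
  fixes N :: "complex ^ 'n ^ 'n"
  assumes "dominant (\<lambda>x. N *v x)" "x \<noteq> 0"
  shows "N *v x \<noteq> 0"
proof -
  have "w = 0" if w: "transpose N *v w = 0" for w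
  proof (rule ccontr)
    assume "w \<noteq> 0"
    then obtain i where i: "w $ i \<noteq> 0" by (auto simp: vec_eq_iff)
    define q :: "complex ^ 'n \<Rightarrow> complex" where "q = (\<lambda>y. \<Sum>j\<in>UNIV. w $ j * y $ j)"
    have "homogeneous_form 1 q"
      unfolding q_def by (intro homogeneous_form_sum homogeneous_form_cmult homogeneous_form_coord)
    moreover have "q (axis i 1) \<noteq> 0"
      using i by (simp add: q_def axis_def if_distrib[of "\<lambda>a. _ * a"] cong: if_cong)
    ultimately obtain y where "q (N *v y) \<noteq> 0" using dominantD[OF assms(1)] by blast
    moreover have "q (N *v y) = (\<Sum>l\<in>UNIV. (transpose N *v w) $ l * y $ l)"
      unfolding q_def matrix_vector_mult_def transpose_def
      by (simp add: sum_distrib_left sum_distrib_right mult_ac) (rule sum.swap)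
    ultimately show False unfolding w by simp
  qed
  then have "invertible (transpose N)"
    using matrix_left_invertible_ker invertible_left_inverse by blast
  then have "invertible N" by (simp add: invertible_det_nz)
  then show ?thesis
    using assms(2) matrix_left_invertible_ker invertible_left_inverse by blast
qed

lemma invertible_morphism_linear:
  fixes F G :: "complex ^ 3 \<Rightarrow> complex ^ 3"
  assumes F: "represents F \<Psi>" and reg: "regular_map \<Psi>"
    and G: "homogeneous_map G" "dominant G" and FG: "same_rational_map (F \<circ> G) (\<lambda>x. x)"
  shows "\<exists>A. same_rational_map (\<lambda>x. A *v x) F \<and> (\<forall>x. x \<noteq> 0 \<longrightarrow> A *v x \<noteq> 0)"
proof -
  obtain L where L: "same_rational_map L F"
    and L': "\<forall>H x. same_rational_map H F \<and> H x \<noteq> 0 \<longrightarrow> L x \<noteq> 0"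
    using reduced_representative[OF represents_hom[OF F]] by blast
  have L_nz: "L x \<noteq> 0" if x: "x \<noteq> 0" for x
  proof -
    obtain H where "represents H \<Psi>" "H x \<noteq> 0"
      using reg x unfolding regular_map_def regular_at_def by blast
    then show ?thesis using L' represents_same[OF _ F] by blast
  qed
  obtain d where d: "\<And>i. homogeneous_form d (\<lambda>x. L x $ i)"
    using homogeneous_map_forms[OF same_rational_map_homogeneous(1)[OF L]] by blast
  have "same_rational_map (L \<circ> G) (\<lambda>x. x)"
    using same_rational_map_compose_dominant[OF L same_rational_map_refl[OF G(1)] G(2)] FG
    by (rule same_rational_map_trans)
  from degree_of_invertible_morphism[OF d L_nz G(1) this] have "d = 1" .
  then obtain A where "L = (\<lambda>x. A *v x)" using linear_forms_matrix d by blast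
  then show ?thesis using L L_nz by metis
qed

theorem theorem1p2:
  fixes \<Phi> :: "(3, 3) rational_map" and k :: nat
  assumes "birational_map \<Phi>"
    and "k \<ge> 1"
    and "regular_map (iterate_map k \<Phi>)"
    and "\<not> (\<exists>f :: (3, 2) rational_map.
              \<not> constant_map f \<and> composable f \<Phi> \<and> compose_map f \<Phi> = f)"
  shows "regular_map \<Phi>"
proof -
  obtain F R where F: "represents F \<Phi>" "dominant F" and R: "homogeneous_map R" "dominant R"
    and FR: "same_rational_map (F \<circ> R) (\<lambda>x. x)"
    using birational_representatives[OF assms(1)] by blast
  have hF: "homogeneous_map F" using represents_hom[OF F(1)] .
  have Fk: "homogeneous_map (F ^^ k)" "dominant (F ^^ k)" using iterate_dominant[OF hF F(2)] by auto
  have Rk: "homogeneous_map (R ^^ k)" "dominant (R ^^ k)" using iterate_dominant[OF R] by auto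
  obtain A where A: "same_rational_map (\<lambda>x. A *v x) (F ^^ k)" and A_nz: "\<And>x. x \<noteq> 0 \<Longrightarrow> A *v x \<noteq> 0"
    using invertible_morphism_linear[OF represents_iterate[OF F] assms(3) Rk
        iterate_right_inverse[OF hF F(2) R FR]] by blast
  have A_dom: "dominant (\<lambda>x. A *v x)"
    by (rule dominant_cong[OF same_rational_map_sym[OF A] Fk(2)])
  have comm: "same_rational_map (F \<circ> (\<lambda>x. A *v x)) ((\<lambda>x. A *v x) \<circ> F)"
  proof (rule same_rational_map_trans)
    show "same_rational_map (F \<circ> (\<lambda>x. A *v x)) (F \<circ> F ^^ k)"
      by (rule same_rational_map_compose_dominant[OF same_rational_map_refl[OF hF] A A_dom])
    have "F \<circ> F ^^ k = F ^^ k \<circ> F" by (simp add: fun_eq_iff funpow_swap1)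
    then show "same_rational_map (F \<circ> F ^^ k) ((\<lambda>x. A *v x) \<circ> F)"
      using same_rational_map_compose_dominant[OF same_rational_map_sym[OF A]
          same_rational_map_refl[OF hF] F(2)] by (simp only:)
  qed
  have inv: "\<exists>j v. \<forall>x. K x = K x $ j *s v"
    if K: "homogeneous_map K" and KA: "\<And>x i j. K (A *v x) $ i * K x $ j = K (A *v x) $ j * K x $ i"
    for K :: "complex ^ 3 \<Rightarrow> complex ^ 3"
  proof -
    have K_FA: "same_rational_map (K \<circ> F ^^ k) (K \<circ> (\<lambda>x. A *v x))"
      by (rule same_rational_map_compose_dominant[OF same_rational_map_refl[OF K]
            same_rational_map_sym[OF A] Fk(2)])
    moreover have "same_rational_map (K \<circ> (\<lambda>x. A *v x)) K"
      using same_rational_map_homogeneous(2)[OF K_FA] K KA unfolding same_rational_map_def by simp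
    ultimately have "same_rational_map (K \<circ> F ^^ k) K" by (rule same_rational_map_trans)
    from invariant_map_constant[OF F assms(2,4) this] show ?thesis .
  qed
  obtain N where N: "same_rational_map (\<lambda>x. N *v x) F"
    using commuting_map_linear[OF hF A_nz _ inv] comm
    unfolding same_rational_map_def o_apply by blast
  have "represents (\<lambda>x. N *v x) \<Phi>" by (rule represents_cong[OF N F(1)])
  moreover have "N *v x \<noteq> 0" if "x \<noteq> 0" for x
    by (rule dominant_linear_nowhere_zero[OF dominant_cong[OF same_rational_map_sym[OF N] F(2)] that])
  ultimately show ?thesis unfolding regular_map_def regular_at_def by blast
qed

end
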